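(* Let $m\le n$ be positive integers. Given a positive integer $r\le\min\{m,n-1\}$ and positive integers $d_1\mid d_2\mid\cdots\mid d_r$, let $z=\prod_{j=1}^{\infty}p_j^{s_j}$ be a positive integer ($s_j$ nonnegative integers) such that $d_r\mid z$. Then the density $\mu(\mathcal{S})$ exists for $$\mathcal{S}=\{D=(D_{i,j})_{n\times m}\in\mathbb{S}:\ D_{i,i}=d_i\ \text{for all } i\le r\},$$ and $$\mu(\mathcal{S})=\prod_{j=1}^{\infty}\mu_{p_j^{s_j+1}}(\mathcal{S}).$$
   Context: $p_j$ is the $j$-th smallest prime. For a positive integer $k$, $\mathbb{Z}_{(k)}=\{-k,\dots,k\}$. The Smith normal form (SNF) of an $n\times m$ matrix $M$ over $\mathbb{Z}$ or $\mathbb{Z}/q\mathbb{Z}$ is the diagonal matrix $PMQ$ ($P,Q$ invertible) with diagonal entries $d_1\mid d_2\mid\cdots\mid d_m$ (trailing entries may be $0$); the entries are unique up to units, and are taken nonnegative over $\mathbb{Z}$. The SNF of the zero matrix is itself. $\mathbb{S}$ is the set of $n\times m$ diagonal integer matrices whose diagonal entries $(d_1,\dots,d_m)$ are nonnegative with $d_{i+1}$ a multiple of $d_i$ for $1\le i\le m-1$. For $\mathcal{S}\subseteq\mathbb{S}$, $\mu^{(k)}(\mathcal{S})$ is the probability that $\mathrm{SNF}(M)\in\mathcal{S}$ for a random $n\times m$ matrix $M$ with independent entries uniform on $\mathbb{Z}_{(k)}$, and $\mu(\mathcal{S})=\lim_{k\to\infty}\mu^{(k)}(\mathcal{S})$ if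 the limit exists. For a prime $p$ and positive integer $s$, $\mu_{p^s}(\mathcal{S})$ is the probability, for an $n\times m$ matrix $M$ with independent entries uniform on $\mathbb{Z}/p^s\mathbb{Z}$, that $\mathrm{SNF}(M)\in\mathcal{S}\ (\mathrm{mod}\ p^s)$, i.e. that some $D\in\mathcal{S}$ has, mod $p^s$, the same diagonal entries as $\mathrm{SNF}(M)$ up to multiplication of each entry by a unit of $\mathbb{Z}/p^s\mathbb{Z}$. The infinite product is the limit of its partial products (all factors lie in $[0,1]$). *)

theory Defs
  imports
    "HOL-Probability.Product_PMF"
    "HOL-Library.Infinite_Set"
    "HOL-Number_Theory.Cong"
    "HOL-Computational_Algebra.Primes"
    "Jordan_Normal_Form.Matrix"
begin

text \<open>
  Throughout, \<open>n \<times> m\<close> matrices are assumed to satisfy \<open>m \<le> n\<close>. Rows and columns are indexed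
  from \<open>0\<close>, so the diagonal entries \<open>d\<^sub>1, \<dots>, d\<^sub>m\<close> are \<open>D $$ (0,0), \<dots>, D $$ (m-1,m-1)\<close>.
\<close>

definition smith_matrices :: "nat \<Rightarrow> nat \<Rightarrow> int mat set" where
  "smith_matrices n m =
    {D \<in> carrier_mat n m. diagonal_mat D \<and> (\<forall>i<m. 0 \<le> D $$ (i,i)) \<and>
       (\<forall>i. Suc i < m \<longrightarrow> D $$ (i,i) dvd D $$ (Suc i, Suc i))}"

text \<open>
  The Smith normal form is a relation here. Over the integers such a \<open>D\<close> exists and is unique, so
  \<open>\<exists>D\<in>S. is_snf M D\<close> says that the Smith normal form of \<open>M\<close> belongs to \<open>S\<close>.
\<close>

definition is_snf :: "int mat \<Rightarrow> int mat \<Rightarrow> bool" where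
  "is_snf M D \<longleftrightarrow>
    D \<in> smith_matrices (dim_row M) (dim_col M) \<and>
    (\<exists>P \<in> carrier_mat (dim_row M) (dim_row M). \<exists>Q \<in> carrier_mat (dim_col M) (dim_col M).
       invertible_mat P \<and> invertible_mat Q \<and> P * M * Q = D)"

text \<open>
  Matrices over \<open>\<int>/q\<int>\<close> are represented by integer matrices, and equality by entrywise congruence.
\<close>

definition cong_mat :: "nat \<Rightarrow> int mat \<Rightarrow> int mat \<Rightarrow> bool" where
  "cong_mat q A B \<longleftrightarrow>
    dim_row A = dim_row B \<and> dim_col A = dim_col B \<and>
    (\<forall>i<dim_row A. \<forall>j<dim_col A. [A $$ (i,j) = B $$ (i,j)] (mod int q))"

definition invertible_mat_mod :: "nat \<Rightarrow> int mat \<Rightarrow> bool" where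
  "invertible_mat_mod q A \<longleftrightarrow>
    square_mat A \<and>
    (\<exists>B \<in> carrier_mat (dim_row A) (dim_row A).
       cong_mat q (A * B) (1\<^sub>m (dim_row A)) \<and> cong_mat q (B * A) (1\<^sub>m (dim_row A)))"

definition is_snf_mod :: "nat \<Rightarrow> int mat \<Rightarrow> int mat \<Rightarrow> bool" where
  "is_snf_mod q M E \<longleftrightarrow>
    E \<in> carrier_mat (dim_row M) (dim_col M) \<and>
    (\<forall>i<dim_row M. \<forall>j<dim_col M. i \<noteq> j \<longrightarrow> [E $$ (i,j) = 0] (mod int q)) \<and>
    (\<forall>i. Suc i < dim_col M \<longrightarrow> (\<exists>c. [E $$ (Suc i, Suc i) = c * E $$ (i,i)] (mod int q))) \<and>
    (\<exists>P \<in> carrier_mat (dim_row M) (dim_row M). \<exists>Q \<in> carrier_mat (dim_col M) (dim_col M).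
       invertible_mat_mod q P \<and> invertible_mat_mod q Q \<and> cong_mat q (P * M * Q) E)"

text \<open>
  Over \<open>\<int>/q\<int>\<close> the Smith normal form is unique only up to units, so in the next definition it does
  not matter which form \<open>E\<close> of \<open>M\<close> is taken. The units of \<open>\<int>/q\<int>\<close> are the classes coprime to \<open>q\<close>.
\<close>

definition snf_in_mod :: "nat \<Rightarrow> int mat set \<Rightarrow> int mat \<Rightarrow> bool" where
  "snf_in_mod q S M \<longleftrightarrow>
    (\<exists>E. is_snf_mod q M E \<and>
      (\<exists>D\<in>S. \<forall>i<dim_col M. \<exists>u. coprime u (int q) \<and> [D $$ (i,i) = u * E $$ (i,i)] (mod int q)))"

definition random_mat :: "nat \<Rightarrow> nat \<Rightarrow> int set \<Rightarrow> int mat pmf" where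
  "random_mat n m A =
    map_pmf (Matrix.mat n m) (Pi_pmf ({..<n} \<times> {..<m}) 0 (\<lambda>_. pmf_of_set A))"

definition mu_box :: "nat \<Rightarrow> nat \<Rightarrow> nat \<Rightarrow> int mat set \<Rightarrow> real" where
  "mu_box n m k S =
    measure_pmf.prob (random_mat n m {- int k..int k}) {M. \<exists>D\<in>S. is_snf M D}"

text \<open>The value of \<open>mu\<close> is meaningful only if the sequence \<open>\<lambda>k. mu_box n m k S\<close> converges.\<close>

definition mu :: "nat \<Rightarrow> nat \<Rightarrow> int mat set \<Rightarrow> real" where
  "mu n m S = lim (\<lambda>k. mu_box n m k S)"

definition mu_mod :: "nat \<Rightarrow> nat \<Rightarrow> nat \<Rightarrow> int mat set \<Rightarrow> real" where
  "mu_mod n m q S = measure_pmf.prob (random_mat n m {0..<int q}) {M. snf_in_mod q S M}"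

text \<open>Counted from \<open>0\<close>: \<open>nth_prime 0 = 2\<close>.\<close>

definition nth_prime :: "nat \<Rightarrow> nat" where
  "nth_prime j = enumerate {p. prime p} j"

end

theory Submission
  imports Defs "Jordan_Normal_Form.Determinant" "Jordan_Normal_Form.Column_Operations"
begin

text \<open>
  The theorem is a local-global principle combined with a sieve.

  \<^emph>\<open>Local-global.\<close> The Smith form of an integer matrix \<open>M\<close> starts with \<open>d 0, \<dots>, d (r - 1)\<close> if and only
  if it does so up to \<open>p\<close>-adic units for every prime \<open>p\<close>. As the valuation of each \<open>d i\<close> at
  \<open>p = nth_prime j\<close> is at most \<open>s j\<close>, it is visible modulo \<open>p ^ (s j + 1)\<close>; so the local condition
  depends only on \<open>M\<close> modulo \<open>p ^ (s j + 1)\<close> and is the condition defining the factor at \<open>p\<close>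
  (\<open>exists_snf_in_smith_with_iff\<close>). This needs the existence of the Smith form over the integers
  and its uniqueness modulo prime powers.

  \<^emph>\<open>Finitely many primes.\<close> The conjunction of the local conditions at finitely many primes is
  periodic, so its density exists and is the proportion among residues; by the Chinese remainder
  theorem this proportion is the product of the local ones (\<open>periodic_box_limit\<close>,
  \<open>prob_pairwise_coprime_moduli\<close>). These products decrease to a limit, which bounds the density
  sought from above.

  \<^emph>\<open>The tail.\<close> It remains to see that, uniformly in large boxes, the local condition rarely fails at
  any prime \<open>p > N\<close>. If \<open>p\<close> does not divide \<open>z\<close>, failure means that \<open>M\<close> has rank less than \<open>r\<close>
  modulo \<open>p\<close>. Because \<open>r < n\<close>, this makes the columns of an \<open>(r + 1) \<times> r\<close> block dependent modulo \<open>p\<close>,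
  which for a fixed \<open>p\<close> has probability of order \<open>1 / p ^ 2\<close>. This can be summed over the primes up to
  the size \<open>k\<close> of the box. Beyond \<open>k\<close> one uses instead that such a \<open>p\<close> divides the determinant of a
  square block; a nonzero determinant has boundedly many prime factors above \<open>k\<close>, and for each of
  them the last row is still random. An induction on \<open>r\<close>, adding one column and one row
  at a time, gives the bound \<open>7 * r / N\<close> (\<open>prob_degenerate_le\<close>).
\<close>

section \<open>Smith normal forms over the integers\<close>

text \<open>
  Unimodularity is expressed by the determinant, because determinants of elementary and of block
  matrices are easy to multiply out; an inverse is only produced at the end, from the adjugate.
\<close>
definition smith_equiv :: "int mat \<Rightarrow> int mat \<Rightarrow> bool" where
  "smith_equiv M N \<longleftrightarrow>
    (\<exists>P \<in> carrier_mat (dim_row M) (dim_row M). \<exists>Q \<in> carrier_mat (dim_col M) (dim_col M).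
       det P dvd 1 \<and> det Q dvd 1 \<and> N = P * M * Q)"

lemma smith_equivI:
  assumes "M \<in> carrier_mat n m" "P \<in> carrier_mat n n" "Q \<in> carrier_mat m m"
    and "det P dvd 1" "det Q dvd 1" "N = P * M * Q"
  shows "smith_equiv M N"
  using assms unfolding smith_equiv_def by auto

lemma smith_equiv_carrier:
  "smith_equiv M N \<Longrightarrow> M \<in> carrier_mat n m \<Longrightarrow> N \<in> carrier_mat n m"
  unfolding smith_equiv_def by auto

lemma smith_equiv_refl: "smith_equiv M M"
  by (rule smith_equivI[of M "dim_row M" "dim_col M" "1\<^sub>m (dim_row M)" "1\<^sub>m (dim_col M)"]) auto

lemma smith_equiv_trans:
  assumes "smith_equiv L M" "smith_equiv M N"
  shows "smith_equiv L N"
proof -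
  define n m where "n = dim_row L" and "m = dim_col L"
  have L: "L \<in> carrier_mat n m" by (simp add: n_def m_def)
  have M: "M \<in> carrier_mat n m" using smith_equiv_carrier[OF assms(1) L] .
  obtain P Q where PQ: "P \<in> carrier_mat n n" "Q \<in> carrier_mat m m" "det P dvd 1" "det Q dvd 1"
    "M = P * L * Q"
    using assms(1) L unfolding smith_equiv_def by auto
  obtain P' Q' where PQ': "P' \<in> carrier_mat n n" "Q' \<in> carrier_mat m m" "det P' dvd 1" "det Q' dvd 1"
    "N = P' * M * Q'"
    using assms(2) M unfolding smith_equiv_def by auto
  have "P' * (P * L * Q) * Q' = (P' * P) * L * (Q * Q')"
    using PQ(1,2) PQ'(1,2) L
    by (simp add: assoc_mult_mat[of _ n n _ n _ m] assoc_mult_mat[of _ n n _ m _ m]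
        assoc_mult_mat[of _ n m _ m _ m])
  moreover have "det (P' * P) dvd 1" "det (Q * Q') dvd 1"
    using PQ(3,4) PQ'(3,4)
    by (simp_all only: det_mult[OF PQ'(1) PQ(1)] det_mult[OF PQ(2) PQ'(2)] is_unit_mult_iff simp_thms)
  ultimately show ?thesis
    using PQ PQ' by (intro smith_equivI[OF L, of "P' * P" "Q * Q'"]) simp_all
qed

lemma smith_equiv_addrow:
  assumes M: "M \<in> carrier_mat n m" and "k < n" "l < n" "k \<noteq> l"
  shows "smith_equiv M (addrow a k l M)"
  using assms addrow_mat[OF M \<open>l < n\<close>, of a k]
  by (intro smith_equivI[OF M, of "addrow_mat n a k l" "1\<^sub>m m"]) (auto simp: det_addrow_mat)

lemma smith_equiv_addcol:
  assumes M: "M \<in> carrier_mat n m" and "k < m" "l < m" "k \<noteq> l"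
  shows "smith_equiv M (addcol a k l M)"
  using assms addcol_mat[OF M \<open>l < m\<close>, of a k]
  by (intro smith_equivI[OF M, of "1\<^sub>m n" "addrow_mat m a l k"]) (auto simp: det_addrow_mat)

lemma smith_equiv_swaprows:
  assumes M: "M \<in> carrier_mat n m" and "k < n" "l < n"
  shows "smith_equiv M (swaprows k l M)"
proof (cases "k = l")
  case True
  then have "swaprows k l M = M" using M by (intro eq_matI) auto
  then show ?thesis by (simp add: smith_equiv_refl)
next
  case False
  then show ?thesis
    using assms swaprows_mat[OF M \<open>k < n\<close> \<open>l < n\<close>]
    by (intro smith_equivI[OF M, of "swaprows_mat n k l" "1\<^sub>m m"]) (auto simp: det_swaprows_mat)
qed

lemma smith_equiv_swapcols:
  assumes M: "M \<in> carrier_mat n m" and "k < m" "l < m"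
  shows "smith_equiv M (swapcols k l M)"
proof (cases "k = l")
  case True
  then have "swapcols k l M = M" using M by (intro eq_matI) auto
  then show ?thesis by (simp add: smith_equiv_refl)
next
  case False
  then show ?thesis
    using assms swapcols_mat[OF M \<open>k < m\<close> \<open>l < m\<close>]
    by (intro smith_equivI[OF M, of "1\<^sub>m n" "swaprows_mat m k l"]) (auto simp: det_swaprows_mat)
qed

lemma det_unit_imp_invertible_mat:
  fixes P :: "int mat"
  assumes P: "P \<in> carrier_mat n n" and "det P dvd 1"
  shows "invertible_mat P"
proof -
  have sq: "det P * det P = 1" using assms(2) by (auto simp: abs_if split: if_splits)
  define B where "B = det P \<cdot>\<^sub>m adj_mat P"
  have B: "B \<in> carrier_mat n n" using adj_mat(1)[OF P] by (simp add: B_def)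
  have "P * B = 1\<^sub>m n"
    unfolding B_def using mult_smult_distrib[OF P adj_mat(1)[OF P]] adj_mat(2)[OF P] sq
    by (auto intro!: eq_matI)
  moreover have "B * P = 1\<^sub>m n"
    unfolding B_def using mult_smult_assoc_mat[OF adj_mat(1)[OF P] P] adj_mat(3)[OF P] sq
    by (auto intro!: eq_matI)
  ultimately show ?thesis
    unfolding invertible_mat_def inverts_mat_def using P B by auto
qed

lemma smith_equiv_block:
  assumes B: "B \<in> carrier_mat n m" and eq: "smith_equiv B D"
  shows "smith_equiv (four_block_mat (mat 1 1 (\<lambda>_. g)) (0\<^sub>m 1 m) (0\<^sub>m n 1) B)
    (four_block_mat (mat 1 1 (\<lambda>_. \<bar>g\<bar>)) (0\<^sub>m 1 m) (0\<^sub>m n 1) D)"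
proof -
  obtain P Q where PQ: "P \<in> carrier_mat n n" "Q \<in> carrier_mat m m" "det P dvd 1" "det Q dvd 1"
    "D = P * B * Q"
    using eq B unfolding smith_equiv_def by auto
  define e :: int where "e = (if g < 0 then -1 else 1)"
  define E where "E = mat 1 1 (\<lambda>_. e)"
  define G where "G = mat 1 1 (\<lambda>_. g)"
  define P' where "P' = four_block_mat E (0\<^sub>m 1 n) (0\<^sub>m n 1) P"
  define Q' where "Q' = four_block_mat (1\<^sub>m 1) (0\<^sub>m 1 m) (0\<^sub>m m 1) Q"
  have E: "E \<in> carrier_mat 1 1" by (simp add: E_def)
  have G: "G \<in> carrier_mat 1 1" by (simp add: G_def)
  have "det P' = det E * det P"
    unfolding P'_def by (rule det_four_block_mat_upper_right_zero[OF E refl _ PQ(1)]) simp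
  then have dP: "det P' dvd 1" using PQ(3) det_single[OF E] by (auto simp: E_def e_def)
  have "det Q' = det (1\<^sub>m 1) * det Q"
    unfolding Q'_def by (rule det_four_block_mat_upper_right_zero[OF _ refl _ PQ(2)]) simp_all
  then have dQ: "det Q' dvd 1" using PQ(4) by simp
  have EG: "E * G = mat 1 1 (\<lambda>_. \<bar>g\<bar>)"
    by (rule eq_matI) (auto simp: E_def G_def e_def scalar_prod_def)
  have 1: "P' * four_block_mat G (0\<^sub>m 1 m) (0\<^sub>m n 1) B
      = four_block_mat (E * G) (0\<^sub>m 1 m) (0\<^sub>m n 1) (P * B)"
    unfolding P'_def using E G PQ(1) B
    by (subst mult_four_block_mat[of _ 1 1 _ n _ n _ _ 1 _ m]) auto
  have 2: "\<dots> * Q' = four_block_mat (E * G) (0\<^sub>m 1 m) (0\<^sub>m n 1) D"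
    unfolding Q'_def PQ(5) using E G PQ(1,2) B
    by (subst mult_four_block_mat[of _ 1 1 _ m _ n _ _ 1 _ m]) auto
  have P': "P' \<in> carrier_mat (1 + n) (1 + n)" "Q' \<in> carrier_mat (1 + m) (1 + m)"
    unfolding P'_def Q'_def using E PQ by (intro four_block_carrier_mat; simp)+
  have "four_block_mat G (0\<^sub>m 1 m) (0\<^sub>m n 1) B \<in> carrier_mat (1 + n) (1 + m)"
    using G B by (rule four_block_carrier_mat)
  then show ?thesis
    unfolding EG[symmetric] G_def[symmetric]
    by (rule smith_equivI[OF _ P' dP dQ]) (simp only: 1 2)
qed

text \<open>
  Division with remainder: if the corner did not divide an entry of its row or column, subtracting
  a multiple of the first column or row and swapping would put the smaller nonzero remainder into
  the corner.
\<close>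
lemma smith_equiv_minimal_corner_dvd:
  fixes M :: "int mat"
  assumes M: "M \<in> carrier_mat (Suc n) (Suc m)" and min: "\<And>N. smith_equiv M N \<Longrightarrow>
    N $$ (0,0) \<noteq> 0 \<Longrightarrow> \<bar>M $$ (0,0)\<bar> \<le> \<bar>N $$ (0,0)\<bar>" and g: "M $$ (0,0) \<noteq> 0"
  shows "j < Suc m \<Longrightarrow> M $$ (0,0) dvd M $$ (0,j)"
    and "i < Suc n \<Longrightarrow> M $$ (0,0) dvd M $$ (i,0)"
proof -
  let ?g = "M $$ (0,0)"
  show "?g dvd M $$ (0,j)" if j: "j < Suc m"
  proof (rule ccontr)
    assume nd: "\<not> ?g dvd M $$ (0,j)"
    then have j0: "j \<noteq> 0" by (metis dvd_refl)
    define N where "N = swapcols 0 j (addcol (- (M $$ (0,j) div ?g)) j 0 M)"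
    have "smith_equiv M N"
      unfolding N_def using M j j0
      by (intro smith_equiv_trans[OF smith_equiv_addcol[OF M, of j 0] smith_equiv_swapcols]) auto
    moreover have "N $$ (0,0) = M $$ (0,j) mod ?g"
      using M j j0 by (simp add: N_def minus_div_mult_eq_mod[symmetric] algebra_simps)
    ultimately have "\<bar>?g\<bar> \<le> \<bar>M $$ (0,j) mod ?g\<bar>"
      using min[of N] nd by (simp add: dvd_eq_mod_eq_0)
    then show False using abs_mod_less[OF g, of "M $$ (0,j)"] by simp
  qed
  show "?g dvd M $$ (i,0)" if i: "i < Suc n"
  proof (rule ccontr)
    assume nd: "\<not> ?g dvd M $$ (i,0)"
    then have i0: "i \<noteq> 0" by (metis dvd_refl)
    define N where "N = swaprows 0 i (addrow (- (M $$ (i,0) div ?g)) i 0 M)"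
    have "smith_equiv M N"
      unfolding N_def using M i i0
      by (intro smith_equiv_trans[OF smith_equiv_addrow[OF M, of i 0] smith_equiv_swaprows]) auto
    moreover have "N $$ (0,0) = M $$ (i,0) mod ?g"
      using M i i0 by (simp add: N_def minus_div_mult_eq_mod[symmetric] algebra_simps)
    ultimately have "\<bar>?g\<bar> \<le> \<bar>M $$ (i,0) mod ?g\<bar>"
      using min[of N] nd by (simp add: dvd_eq_mod_eq_0)
    then show False using abs_mod_less[OF g, of "M $$ (i,0)"] by simp
  qed
qed

lemma dvd_mult_mat:
  fixes A B C :: "int mat"
  assumes "A \<in> carrier_mat n n" "B \<in> carrier_mat n m" "C \<in> carrier_mat m m"
    and "\<And>i j. i < n \<Longrightarrow> j < m \<Longrightarrow> g dvd B $$ (i,j)" and "i < n" "j < m"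
  shows "g dvd (A * B * C) $$ (i,j)"
proof -
  have "(A * B * C) $$ (i,j)
      = (\<Sum>k\<in>{0..<n}. A $$ (i,k) * (\<Sum>l\<in>{0..<m}. B $$ (k,l) * C $$ (l,j)))"
    using assms by (simp add: scalar_prod_def)
  also have "g dvd \<dots>"
    using assms by (intro dvd_sum dvd_mult[OF dvd_sum[OF dvd_mult2]]) auto
  finally show ?thesis .
qed

text \<open>
  Among all equivalent matrices with nonzero corner take one whose corner \<open>g\<close> is smallest in
  absolute value. Then \<open>g\<close> divides its row and its column, which can therefore be cleared. The
  corner is still minimal after adding any other row to the first one, so \<open>g\<close> divides the
  remaining block too, and hence all entries of the Smith form which the induction hypothesis
  gives for that block.
\<close>
lemma exists_smith_equiv:
  "M \<in> carrier_mat n m \<Longrightarrow> m \<le> n \<Longrightarrow> \<exists>D\<in>smith_matrices n m. smith_equiv M D"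
proof (induction m arbitrary: n M)
  case 0
  then show ?case
    by (intro bexI[of _ M] smith_equiv_refl) (auto simp: smith_matrices_def diagonal_mat_def)
next
  case (Suc m n')
  obtain n where n': "n' = Suc n" "m \<le> n" using Suc.prems by (cases n') auto
  have M: "M \<in> carrier_mat (Suc n) (Suc m)" using Suc.prems n' by simp
  show ?case
  proof (cases "\<exists>i<Suc n. \<exists>j<Suc m. M $$ (i,j) \<noteq> 0")
    case False
    then show ?thesis using M n'
      by (intro bexI[of _ M] smith_equiv_refl) (auto simp: smith_matrices_def diagonal_mat_def)
  next
    case True
    then obtain i j where ij: "i < Suc n" "j < Suc m" "M $$ (i,j) \<noteq> 0" by auto
    define W where "W = {N. smith_equiv M N \<and> N $$ (0,0) \<noteq> 0}"
    have "smith_equiv M (swapcols 0 j (swaprows 0 i M))"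
      using ij M
      by (intro smith_equiv_trans[OF smith_equiv_swaprows[OF M, of 0 i] smith_equiv_swapcols]) auto
    then have "swapcols 0 j (swaprows 0 i M) \<in> W" using M ij by (auto simp: W_def)
    then obtain N where N: "N \<in> W" "\<forall>N'. N' \<in> W \<longrightarrow> nat \<bar>N $$ (0,0)\<bar> \<le> nat \<bar>N' $$ (0,0)\<bar>"
      using ex_has_least_nat[of "\<lambda>N. N \<in> W" _ "\<lambda>N. nat \<bar>N $$ (0,0)\<bar>"] by blast
    define g where "g = N $$ (0,0)"
    have g: "g \<noteq> 0" using N by (auto simp: W_def g_def)
    \<comment> \<open>Everything below stays inside the set of minimisers that keep \<open>g\<close> itself in the corner.\<close>
    define W' where "W' = {N \<in> W. N $$ (0,0) = g}"
    have W'1: "L \<in> carrier_mat (Suc n) (Suc m)" "smith_equiv M L" "L $$ (0,0) = g" if "L \<in> W'" for L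
      using that smith_equiv_carrier[OF _ M] by (auto simp: W_def W'_def)
    have W'2: "L' \<in> W'" if "L \<in> W'" "smith_equiv L L'" "L' $$ (0,0) = g" for L L'
      using that smith_equiv_trans g by (auto simp: W_def W'_def)
    have W'3: "\<bar>L $$ (0,0)\<bar> \<le> \<bar>L' $$ (0,0)\<bar>"
      if "L \<in> W'" "smith_equiv L L'" "L' $$ (0,0) \<noteq> 0" for L L'
      using N(2)[rule_format, of L'] W'1[OF that(1)] that smith_equiv_trans[OF W'1(2)[OF that(1)] that(2)]
      by (auto simp: W_def g_def)
    have W'row: "g dvd L $$ (0,l)" if "L \<in> W'" "l < Suc m" for L l
      using smith_equiv_minimal_corner_dvd(1)[OF W'1(1)[OF that(1)] W'3[OF that(1)], of l]
        that W'1(3)[OF that(1)] g by auto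
    have W'col: "g dvd L $$ (k,0)" if "L \<in> W'" "k < Suc n" for L k
      using smith_equiv_minimal_corner_dvd(2)[OF W'1(1)[OF that(1)] W'3[OF that(1)], of k]
        that W'1(3)[OF that(1)] g by auto
    have NW: "N \<in> W'" using N by (auto simp: W'_def g_def)
    have "k \<le> m \<Longrightarrow> \<exists>L\<in>W'. \<forall>l. 0 < l \<and> l \<le> k \<longrightarrow> L $$ (0,l) = 0" for k
    proof (induction k)
      case 0
      then show ?case using NW by auto
    next
      case (Suc k)
      then obtain L where L: "L \<in> W'" "\<And>l. 0 < l \<Longrightarrow> l \<le> k \<Longrightarrow> L $$ (0,l) = 0" by auto
      define L' where "L' = addcol (- (L $$ (0,Suc k) div g)) (Suc k) 0 L"
      have "L' \<in> W'"
        using W'1[OF L(1)] Suc.prems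
        by (intro W'2[OF L(1)]) (auto simp: L'_def intro!: smith_equiv_addcol)
      moreover have "L' $$ (0,l) = 0" if "0 < l" "l \<le> Suc k" for l
        using that L(2)[of l] W'1[OF L(1)] Suc.prems W'row[OF L(1), of "Suc k"]
        by (cases "l = Suc k") (auto simp: L'_def)
      ultimately show ?case by blast
    qed
    from this[OF order.refl] obtain N1 where N1: "N1 \<in> W'" "\<And>l. 0 < l \<Longrightarrow> l \<le> m \<Longrightarrow> N1 $$ (0,l) = 0" by blast
    have "k \<le> n \<Longrightarrow> \<exists>L\<in>W'. (\<forall>l. 0 < l \<and> l \<le> m \<longrightarrow> L $$ (0,l) = 0) \<and>
        (\<forall>l. 0 < l \<and> l \<le> k \<longrightarrow> L $$ (l,0) = 0)" for k
    proof (induction k)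
      case 0
      then show ?case using N1 by auto
    next
      case (Suc k)
      then obtain L where L: "L \<in> W'" "\<And>l. 0 < l \<Longrightarrow> l \<le> m \<Longrightarrow> L $$ (0,l) = 0"
        "\<And>l. 0 < l \<Longrightarrow> l \<le> k \<Longrightarrow> L $$ (l,0) = 0" by auto
      define L' where "L' = addrow (- (L $$ (Suc k,0) div g)) (Suc k) 0 L"
      have "L' \<in> W'"
        using W'1[OF L(1)] Suc.prems
        by (intro W'2[OF L(1)]) (auto simp: L'_def intro!: smith_equiv_addrow)
      moreover have "L' $$ (0,l) = 0" if "0 < l" "l \<le> m" for l
        using that L(2)[of l] W'1[OF L(1)] Suc.prems by (auto simp: L'_def)
      moreover have "L' $$ (l,0) = 0" if "0 < l" "l \<le> Suc k" for l
        using that L(3)[of l] W'1[OF L(1)] Suc.prems W'col[OF L(1), of "Suc k"]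
        by (cases "l = Suc k") (auto simp: L'_def)
      ultimately show ?case by blast
    qed
    from this[OF order.refl] obtain N2 where N2: "N2 \<in> W'" "\<And>l. 0 < l \<Longrightarrow> l \<le> m \<Longrightarrow> N2 $$ (0,l) = 0"
      "\<And>l. 0 < l \<Longrightarrow> l \<le> n \<Longrightarrow> N2 $$ (l,0) = 0" by blast
    define B where "B = mat n m (\<lambda>(i,j). N2 $$ (Suc i, Suc j))"
    have B: "B \<in> carrier_mat n m" by (simp add: B_def)
    have gB: "g dvd B $$ (i,j)" if ij: "i < n" "j < m" for i j
    proof -
      define L where "L = addrow 1 0 (Suc i) N2"
      have "L \<in> W'"
        using W'1[OF N2(1)] ij N2(3)[of "Suc i"]
        by (intro W'2[OF N2(1)]) (auto simp: L_def intro!: smith_equiv_addrow)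
      from W'row[OF this, of "Suc j"] show ?thesis
        using ij W'1[OF N2(1)] N2(2)[of "Suc j"] by (simp add: L_def B_def)
    qed
    have N2B: "N2 = four_block_mat (mat 1 1 (\<lambda>_. g)) (0\<^sub>m 1 m) (0\<^sub>m n 1) B"
      using W'1[OF N2(1)] N2(2,3) by (intro eq_matI) (auto simp: B_def)
    obtain D where D: "D \<in> smith_matrices n m" "smith_equiv B D"
      using Suc.IH[OF B n'(2)] by blast
    have Dc: "D \<in> carrier_mat n m" using smith_equiv_carrier[OF D(2) B] .
    have gD: "g dvd D $$ (i,j)" if "i < n" "j < m" for i j
      using D(2) B dvd_mult_mat[OF _ B _ gB that] unfolding smith_equiv_def by auto
    define D' where "D' = four_block_mat (mat 1 1 (\<lambda>_. \<bar>g\<bar>)) (0\<^sub>m 1 m) (0\<^sub>m n 1) D"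
    have D'i: "D' $$ (i,j) = (if i = 0 then if j = 0 then \<bar>g\<bar> else 0
        else if j = 0 then 0 else D $$ (i - 1, j - 1))" if "i < Suc n" "j < Suc m" for i j
      using that Dc by (auto simp: D'_def)
    have D'c: "D' \<in> carrier_mat (Suc n) (Suc m)" using Dc by (auto simp: D'_def)
    have "diagonal_mat D'"
      using D D'c unfolding diagonal_mat_def smith_matrices_def by (auto simp: D'i)
    moreover have "0 \<le> D' $$ (i,i)" if "i < Suc m" for i
      using D that n'(2) by (auto simp: D'i smith_matrices_def)
    moreover have "D' $$ (i,i) dvd D' $$ (Suc i, Suc i)" if "Suc i < Suc m" for i
      using D that n'(2) gD[of 0 0] by (cases i) (auto simp: D'i smith_matrices_def)
    ultimately have "D' \<in> smith_matrices (Suc n) (Suc m)"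
      using D'c by (auto simp: smith_matrices_def)
    moreover have "smith_equiv M D'"
      using smith_equiv_trans[OF W'1(2)[OF N2(1)]] smith_equiv_block[OF B D(2), of g] N2B
      by (simp add: D'_def)
    ultimately show ?thesis using n' by blast
  qed
qed

lemma exists_is_snf:
  assumes "M \<in> carrier_mat n m" "m \<le> n"
  shows "\<exists>D. is_snf M D"
proof -
  obtain D where D: "D \<in> smith_matrices n m" "smith_equiv M D"
    using exists_smith_equiv[OF assms] by blast
  obtain P Q where PQ: "P \<in> carrier_mat n n" "Q \<in> carrier_mat m m" "det P dvd 1" "det Q dvd 1"
    "D = P * M * Q"
    using D(2) assms(1) unfolding smith_equiv_def by auto
  have "is_snf M D"
    unfolding is_snf_def
  proof (intro conjI bexI)
    show "D \<in> smith_matrices (dim_row M) (dim_col M)" using D(1) assms(1) by simp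
    show "invertible_mat P" "invertible_mat Q"
      using PQ det_unit_imp_invertible_mat by blast+
  qed (use PQ assms(1) in simp_all)
  then show ?thesis by blast
qed

section \<open>Kernels of integer matrices\<close>

text \<open>
  Dividing a nonzero integer kernel vector by the gcd of its entries makes it nonzero modulo every
  prime at once. This is what turns rational linear algebra into statements modulo all \<open>p\<close>.
\<close>
lemma primitive_kernel_of_det_0:
  fixes A :: "int mat"
  assumes A: "A \<in> carrier_mat n n" and "det A = 0"
  shows "\<exists>v :: nat \<Rightarrow> int. (\<forall>p::nat. prime p \<longrightarrow> (\<exists>j<n. \<not> int p dvd v j)) \<and>
    (\<forall>i<n. (\<Sum>j<n. A $$ (i,j) * v j) = 0)"
proof -
  obtain w where w: "w \<in> carrier_vec n" "w \<noteq> 0\<^sub>v n" "A *\<^sub>v w = 0\<^sub>v n"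
    using assms det_0_iff_vec_prod_zero by blast
  define g where "g = Gcd ((\<lambda>j. w $ j) ` {..<n})"
  obtain j0 where j0: "j0 < n" "w $ j0 \<noteq> 0"
  proof (rule ccontr)
    assume "\<not> thesis"
    then have "w = 0\<^sub>v n" using w(1) that by (intro eq_vecI) auto
    then show False using w(2) by simp
  qed
  have g0: "g \<noteq> 0" using j0 by (auto simp: g_def Gcd_0_iff)
  have gd: "g dvd w $ j" if "j < n" for j
    unfolding g_def using that by (intro Gcd_dvd) auto
  define v where "v j = w $ j div g" for j
  have wv: "w $ j = g * v j" if "j < n" for j using gd[OF that] by (simp add: v_def)
  have "\<exists>j<n. \<not> int p dvd v j" if p: "prime p" for p :: nat
  proof (rule ccontr)
    assume "\<not> (\<exists>j<n. \<not> int p dvd v j)"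
    then have "g * int p dvd Gcd ((\<lambda>j. w $ j) ` {..<n})"
      by (intro Gcd_greatest) (auto simp: wv)
    then have "g * int p dvd g * 1" by (simp add: g_def)
    then have "int p dvd 1" using g0 by (simp only: dvd_mult_cancel_left) simp
    then show False using p by (simp add: prime_nat_iff)
  qed
  moreover have "(\<Sum>j<n. A $$ (i,j) * v j) = 0" if i: "i < n" for i
  proof -
    have "g * (\<Sum>j<n. A $$ (i,j) * v j) = (\<Sum>j<n. A $$ (i,j) * w $ j)"
      by (simp add: sum_distrib_left wv mult_ac)
    also have "\<dots> = (A *\<^sub>v w) $ i"
      using A w(1) i by (simp add: scalar_prod_def lessThan_atLeast0)
    finally show ?thesis using w(3) i g0 by simp
  qed
  ultimately show ?thesis by blast
qed

lemma primitive_kernel_underdetermined: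
  fixes a :: "nat \<Rightarrow> nat \<Rightarrow> int"
  shows "\<exists>v :: nat \<Rightarrow> int. (\<forall>p::nat. prime p \<longrightarrow> (\<exists>j<Suc b. \<not> int p dvd v j)) \<and>
    (\<forall>i<b. (\<Sum>j<Suc b. a i j * v j) = 0)"
proof -
  define A where "A = mat (Suc b) (Suc b) (\<lambda>(i,j). if i < b then a i j else 0)"
  have A: "A \<in> carrier_mat (Suc b) (Suc b)" by (simp add: A_def)
  have "det A = (\<Sum>j<Suc b. A $$ (b,j) * cofactor A b j)"
    by (rule laplace_expansion_row[OF A]) simp
  also have "\<dots> = 0" by (rule sum.neutral) (simp add: A_def)
  finally have "det A = 0" .
  from primitive_kernel_of_det_0[OF A this] obtain v :: "nat \<Rightarrow> int" where
    v: "\<forall>p::nat. prime p \<longrightarrow> (\<exists>j<Suc b. \<not> int p dvd v j)"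
      "\<forall>i<Suc b. (\<Sum>j<Suc b. A $$ (i,j) * v j) = 0" by blast
  have "(\<Sum>j<Suc b. a i j * v j) = 0" if "i < b" for i
  proof -
    have "(\<Sum>j<Suc b. a i j * v j) = (\<Sum>j<Suc b. A $$ (i,j) * v j)"
      using that by (intro sum.cong) (auto simp: A_def)
    then show ?thesis using v(2) that by simp
  qed
  then show ?thesis using v(1) by blast
qed

text \<open>
  The matrix is a function on index pairs, so that the same random function can be restricted
  to blocks of every size: only its first \<open>a\<close> rows and \<open>b\<close> columns are read.
\<close>
definition cols_dependent_mod :: "nat \<Rightarrow> nat \<Rightarrow> nat \<Rightarrow> (nat \<times> nat \<Rightarrow> int) \<Rightarrow> bool" where
  "cols_dependent_mod p a b f \<longleftrightarrow>
    (\<exists>v :: nat \<Rightarrow> int. (\<exists>j<b. \<not> int p dvd v j) \<and> (\<forall>i<a. int p dvd (\<Sum>j<b. f (i,j) * v j)))"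

text \<open>
  Multiplying a relation between the columns by the adjugate gives \<open>det M * v j \<equiv> 0\<close>.
\<close>
lemma cols_dependent_mod_dvd_det:
  assumes p: "prime p" and dep: "cols_dependent_mod p b b f"
  shows "int p dvd det (mat b b f)"
proof -
  obtain v j where v: "j < b" "\<not> int p dvd v j" "\<And>i. i < b \<Longrightarrow> int p dvd (\<Sum>l<b. f (i,l) * v l)"
    using dep unfolding cols_dependent_mod_def by blast
  define M where "M = mat b b f"
  have M: "M \<in> carrier_mat b b" by (simp add: M_def)
  note adj = adj_mat[OF M]
  have "det M * v j = (\<Sum>l<b. (det M \<cdot>\<^sub>m 1\<^sub>m b) $$ (j,l) * v l)"
    using v(1) by (simp add: sum.remove[of "{..<b}" j] if_distrib cong: if_cong)
  also have "\<dots> = (\<Sum>l<b. (\<Sum>k<b. adj_mat M $$ (j,k) * f (k,l)) * v l)"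
    unfolding adj(3)[symmetric] using v(1) adj(1)
    by (intro sum.cong) (auto simp: scalar_prod_def M_def lessThan_atLeast0)
  also have "\<dots> = (\<Sum>k<b. adj_mat M $$ (j,k) * (\<Sum>l<b. f (k,l) * v l))"
    by (simp only: sum_distrib_left sum_distrib_right mult.assoc) (rule sum.swap)
  also have "int p dvd \<dots>" by (intro dvd_sum dvd_mult v(3)) simp
  finally have "int p dvd det M * v j" .
  then show ?thesis using v(2) p by (simp add: M_def prime_dvd_mult_iff)
qed

section \<open>Smith normal forms modulo a prime power\<close>

text \<open>
  If \<open>X\<close> vanishes modulo \<open>q\<close> outside its first \<open>i\<close> columns, then \<open>A * X * B\<close> factors modulo \<open>q\<close>
  through the first \<open>i\<close> rows of \<open>B\<close>, and these have a kernel vector supported on \<open>i + 1\<close>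
  coordinates. The vector can be chosen primitive, which makes it useful modulo prime powers.
\<close>
lemma low_rank_kernel:
  fixes A X B :: "int mat"
  assumes A: "A \<in> carrier_mat n n" and X: "X \<in> carrier_mat n m" and B: "B \<in> carrier_mat m m"
    and i: "i < m" and zero: "\<And>s t. s < n \<Longrightarrow> i \<le> t \<Longrightarrow> t < m \<Longrightarrow> q dvd X $$ (s,t)"
  shows "\<exists>v :: nat \<Rightarrow> int. (\<forall>p::nat. prime p \<longrightarrow> (\<exists>j<Suc i. \<not> int p dvd v j)) \<and>
    (\<forall>k<n. q dvd (\<Sum>l<Suc i. (A * X * B) $$ (k,l) * v l))"
proof -
  obtain v :: "nat \<Rightarrow> int" where v: "\<forall>p::nat. prime p \<longrightarrow> (\<exists>j<Suc i. \<not> int p dvd v j)"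
    "\<And>t. t < i \<Longrightarrow> (\<Sum>l<Suc i. B $$ (t,l) * v l) = 0"
    using primitive_kernel_underdetermined[of i "\<lambda>t l. B $$ (t,l)"] by blast
  have "q dvd (\<Sum>l<Suc i. (A * X * B) $$ (k,l) * v l)" if k: "k < n" for k
  proof -
    have "(\<Sum>l<Suc i. (A * X * B) $$ (k,l) * v l)
        = (\<Sum>l<Suc i. (\<Sum>t<m. (A * X) $$ (k,t) * B $$ (t,l)) * v l)"
    proof (intro sum.cong refl arg_cong2[of _ _ _ _ "(*)"])
      fix l assume "l \<in> {..<Suc i}"
      then show "(A * X * B) $$ (k,l) = (\<Sum>t<m. (A * X) $$ (k,t) * B $$ (t,l))"
        using A X B k i
        by (subst index_mult_mat(1)) (auto simp: scalar_prod_def lessThan_atLeast0 simp del: assoc_mult_mat)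
    qed
    also have "\<dots> = (\<Sum>t<m. (A * X) $$ (k,t) * (\<Sum>l<Suc i. B $$ (t,l) * v l))"
      by (simp only: sum_distrib_left sum_distrib_right mult.assoc) (rule sum.swap)
    also have "q dvd \<dots>"
    proof (rule dvd_sum)
      fix t assume t: "t \<in> {..<m}"
      show "q dvd (A * X) $$ (k,t) * (\<Sum>l<Suc i. B $$ (t,l) * v l)"
      proof (cases "t < i")
        case True
        then show ?thesis using v(2) by simp
      next
        case False
        have "q dvd (A * X) $$ (k,t)"
          using A X k t zero[of _ t] False by (auto simp: scalar_prod_def intro!: dvd_sum dvd_mult)
        then show ?thesis by (rule dvd_mult2)
      qed
    qed
    finally show ?thesis .
  qed
  then show ?thesis using v(1) by blast
qed

lemma cong_mat_refl: "cong_mat q A A"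
  by (simp add: cong_mat_def)

lemma cong_mat_sym: "cong_mat q A B \<Longrightarrow> cong_mat q B A"
  by (auto simp: cong_mat_def cong_sym)

lemma cong_mat_trans: "cong_mat q A B \<Longrightarrow> cong_mat q B C \<Longrightarrow> cong_mat q A C"
  unfolding cong_mat_def by (metis cong_trans)

lemma cong_mat_mult:
  assumes "cong_mat q A A'" "cong_mat q B B'" "dim_col A = dim_row B"
  shows "cong_mat q (A * B) (A' * B')"
  using assms unfolding cong_mat_def
  by (auto simp: scalar_prod_def intro!: cong_sum cong_mult)

lemma cong_mat_carrier: "cong_mat q A B \<Longrightarrow> A \<in> carrier_mat n m \<Longrightarrow> B \<in> carrier_mat n m"
  by (auto simp: cong_mat_def)

text \<open>
  The shape that the Smith form modulo \<open>q\<close> must have, separated from the equivalence with \<open>M\<close>.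
\<close>
definition diag_chain_mod :: "nat \<Rightarrow> int mat \<Rightarrow> bool" where
  "diag_chain_mod q X \<longleftrightarrow>
    (\<forall>i<dim_row X. \<forall>j<dim_col X. i \<noteq> j \<longrightarrow> [X $$ (i,j) = 0] (mod int q)) \<and>
    (\<forall>i. Suc i < dim_col X \<longrightarrow> (\<exists>c. [X $$ (Suc i, Suc i) = c * X $$ (i,i)] (mod int q)))"

lemma diag_chain_mod_dvd_mono:
  assumes X: "diag_chain_mod q X" and g: "g dvd int q" and "i \<le> j" "j < dim_col X"
    and "g dvd X $$ (i,i)"
  shows "g dvd X $$ (j,j)"
  using assms(3-5)
proof (induction rule: dec_induct)
  case (step j)
  then obtain c where "[X $$ (Suc j, Suc j) = c * X $$ (j,j)] (mod int q)"
    using X unfolding diag_chain_mod_def by blast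
  then have "[X $$ (Suc j, Suc j) = c * X $$ (j,j)] (mod g)" using g cong_dvd_modulus by blast
  then show ?case using step by (simp add: cong_dvd_iff)
qed

text \<open>
  Uniqueness of the Smith form modulo a prime power, up to units. If \<open>p ^ a\<close> divides the \<open>i\<close>-th
  diagonal entry of \<open>X\<close>, it divides all later ones, so the primitive vector of \<open>low_rank_kernel\<close> is
  killed by the diagonal matrix \<open>Y\<close> modulo \<open>p ^ a\<close>. At a coordinate \<open>j \<le> i\<close> where the vector is
  prime to \<open>p\<close> this says that \<open>p ^ a\<close> divides the \<open>j\<close>-th entry of \<open>Y\<close>, hence also the \<open>i\<close>-th.
\<close>
lemma diag_chain_mod_dvd_transfer:
  assumes X: "X \<in> carrier_mat n m" "diag_chain_mod q X"
    and Y: "Y \<in> carrier_mat n m" "diag_chain_mod q Y" and mn: "m \<le> n"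
    and AB: "A \<in> carrier_mat n n" "B \<in> carrier_mat m m" "cong_mat q (A * X * B) Y"
    and p: "prime p" and pq: "p ^ a dvd q" and i: "i < m" and dvd: "int p ^ a dvd X $$ (i,i)"
  shows "int p ^ a dvd Y $$ (i,i)"
proof -
  have pq': "int p ^ a dvd int q" using pq by (metis of_nat_dvd_iff of_nat_power)
  have off: "int p ^ a dvd Z $$ (s,t)"
    if "diag_chain_mod q Z" "Z \<in> carrier_mat n m" "s < n" "t < m" "s \<noteq> t" for Z s t
    using that pq' unfolding diag_chain_mod_def by (auto simp: cong_0_iff intro: dvd_trans)
  have "int p ^ a dvd X $$ (s,t)" if "s < n" "i \<le> t" "t < m" for s t
    using off[OF X(2,1) that(1,3)] diag_chain_mod_dvd_mono[OF X(2) pq' that(2)] that(3) dvd X(1)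
    by (cases "s = t") auto
  from low_rank_kernel[OF AB(1) X(1) AB(2) i this] obtain v :: "nat \<Rightarrow> int" and j where
    v: "j < Suc i" "\<not> int p dvd v j"
      "\<And>k. k < n \<Longrightarrow> int p ^ a dvd (\<Sum>l<Suc i. (A * X * B) $$ (k,l) * v l)"
    using p by blast
  have j: "j < n" "j < m" using v(1) i mn by auto
  have "[(\<Sum>l<Suc i. (A * X * B) $$ (j,l) * v l) = (\<Sum>l<Suc i. Y $$ (j,l) * v l)] (mod int p ^ a)"
  proof (intro cong_sum cong_mult cong_refl)
    fix l assume "l \<in> {..<Suc i}"
    then have "[(A * X * B) $$ (j,l) = Y $$ (j,l)] (mod int q)"
      using AB X i j unfolding cong_mat_def by (auto simp del: index_mult_mat(1))
    then show "[(A * X * B) $$ (j,l) = Y $$ (j,l)] (mod int p ^ a)"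
      using pq' cong_dvd_modulus by blast
  qed
  then have "int p ^ a dvd (\<Sum>l<Suc i. Y $$ (j,l) * v l)"
    using v(3)[OF j(1)] cong_dvd_iff by blast
  also have "(\<Sum>l<Suc i. Y $$ (j,l) * v l)
      = Y $$ (j,j) * v j + (\<Sum>l\<in>{..<Suc i} - {j}. Y $$ (j,l) * v l)"
    using v(1) by (intro sum.remove) auto
  finally have "int p ^ a dvd Y $$ (j,j) * v j"
  proof (subst (asm) dvd_add_left_iff)
    show "int p ^ a dvd (\<Sum>l\<in>{..<Suc i} - {j}. Y $$ (j,l) * v l)"
      using off[OF Y(2,1) j(1)] i by (intro dvd_sum dvd_mult2) auto
  qed
  moreover have "coprime (int p ^ a) (v j)"
    using p v(2) by (simp add: prime_imp_coprime)
  ultimately have "int p ^ a dvd Y $$ (j,j)" by (simp add: coprime_dvd_mult_left_iff)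
  then show ?thesis
    using diag_chain_mod_dvd_mono[OF Y(2) pq', of j i] v(1) i Y(1) by auto
qed

lemma is_snf_mod_iff:
  "is_snf_mod q M E \<longleftrightarrow> E \<in> carrier_mat (dim_row M) (dim_col M) \<and> diag_chain_mod q E \<and>
    (\<exists>P \<in> carrier_mat (dim_row M) (dim_row M). \<exists>Q \<in> carrier_mat (dim_col M) (dim_col M).
       invertible_mat_mod q P \<and> invertible_mat_mod q Q \<and> cong_mat q (P * M * Q) E)"
  unfolding is_snf_mod_def diag_chain_mod_def by auto

lemma is_snf_mod_cong:
  assumes "cong_mat q M M'" "is_snf_mod q M E"
  shows "is_snf_mod q M' E"
proof -
  define n m where "n = dim_row M" and "m = dim_col M"
  have M: "M \<in> carrier_mat n m" by (simp add: n_def m_def)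
  have M': "M' \<in> carrier_mat n m" using cong_mat_carrier[OF assms(1) M] .
  obtain P Q where PQ: "P \<in> carrier_mat n n" "Q \<in> carrier_mat m m"
    "invertible_mat_mod q P" "invertible_mat_mod q Q" "cong_mat q (P * M * Q) E"
    using assms(2) M unfolding is_snf_mod_iff by auto
  have "cong_mat q (P * M' * Q) (P * M * Q)"
    using PQ M M' assms(1) by (intro cong_mat_mult cong_mat_refl) (auto intro: cong_mat_sym)
  then have "cong_mat q (P * M' * Q) E" using PQ(5) cong_mat_trans by blast
  then show ?thesis using PQ M M' assms(2) unfolding is_snf_mod_iff by auto
qed

lemma snf_in_mod_cong:
  assumes "cong_mat q M M'"
  shows "snf_in_mod q S M \<longleftrightarrow> snf_in_mod q S M'"
proof -
  have "dim_col M = dim_col M'" using assms by (simp add: cong_mat_def)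
  then show ?thesis
    using is_snf_mod_cong[OF assms] is_snf_mod_cong[OF cong_mat_sym[OF assms]]
    unfolding snf_in_mod_def by metis
qed

text \<open>
  Two Smith forms of the same matrix are equivalent to each other, through \<open>M\<close>.
\<close>
lemma is_snf_mod_dvd_transfer:
  assumes M: "M \<in> carrier_mat n m" "m \<le> n" and X: "is_snf_mod q M X" and Y: "is_snf_mod q M Y"
    and p: "prime p" "p ^ a dvd q" and i: "i < m" and dvd: "int p ^ a dvd X $$ (i,i)"
  shows "int p ^ a dvd Y $$ (i,i)"
proof -
  obtain P Q where PQ: "P \<in> carrier_mat n n" "Q \<in> carrier_mat m m"
    "invertible_mat_mod q P" "invertible_mat_mod q Q" "cong_mat q (P * M * Q) X"
    using X M unfolding is_snf_mod_iff by auto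
  obtain P' Q' where PQ': "P' \<in> carrier_mat n n" "Q' \<in> carrier_mat m m" "cong_mat q (P' * M * Q') Y"
    using Y M unfolding is_snf_mod_iff by auto
  have Xc: "X \<in> carrier_mat n m" and Yc: "Y \<in> carrier_mat n m"
    using X Y M unfolding is_snf_mod_iff by auto
  obtain B where B: "B \<in> carrier_mat n n" "cong_mat q (B * P) (1\<^sub>m n)"
    using PQ unfolding invertible_mat_mod_def by auto
  obtain C where C: "C \<in> carrier_mat m m" "cong_mat q (Q * C) (1\<^sub>m m)"
    using PQ unfolding invertible_mat_mod_def by auto
  note carr = PQ(1,2) PQ'(1,2) Xc Yc B(1) C(1) M(1)
  have "cong_mat q (P' * (B * X * C) * Q') (P' * (B * (P * M * Q) * C) * Q')"
    using carr by (intro cong_mat_mult cong_mat_refl cong_mat_sym[OF PQ(5)]) auto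
  also have "P' * (B * (P * M * Q) * C) * Q' = P' * ((B * P) * M * (Q * C)) * Q'"
    using carr by (simp add: assoc_mult_mat[of _ n n _ n _ m] assoc_mult_mat[of _ n n _ m _ m]
        assoc_mult_mat[of _ n m _ m _ m])
  finally have "cong_mat q (P' * (B * X * C) * Q') (P' * ((B * P) * M * (Q * C)) * Q')" .
  moreover have "cong_mat q (P' * ((B * P) * M * (Q * C)) * Q') (P' * (1\<^sub>m n * M * 1\<^sub>m m) * Q')"
    using carr by (intro cong_mat_mult cong_mat_refl B(2) C(2)) auto
  moreover have "P' * (1\<^sub>m n * M * 1\<^sub>m m) * Q' = P' * M * Q'" using carr by simp
  ultimately have "cong_mat q (P' * (B * X * C) * Q') Y"
    using PQ'(3) by (metis cong_mat_trans)
  moreover have "P' * (B * X * C) * Q' = (P' * B) * X * (C * Q')"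
    using carr by (simp add: assoc_mult_mat[of _ n n _ n _ m] assoc_mult_mat[of _ n n _ m _ m]
        assoc_mult_mat[of _ n m _ m _ m])
  ultimately have "cong_mat q ((P' * B) * X * (C * Q')) Y" by simp
  from diag_chain_mod_dvd_transfer[OF Xc _ Yc _ M(2) _ _ this p i dvd] show ?thesis
    using carr X Y unfolding is_snf_mod_iff by auto
qed

lemma smith_matrices_dvd_mono:
  assumes "D \<in> smith_matrices n m" "i \<le> j" "j < m"
  shows "D $$ (i,i) dvd D $$ (j,j)"
  using assms(2,3)
proof (induction rule: dec_induct)
  case (step j)
  then show ?case using assms(1) by (auto simp: smith_matrices_def intro: dvd_trans)
qed auto

lemma diag_chain_mod_smith_matrices:
  assumes D: "D \<in> smith_matrices n m" and "m \<le> n"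
  shows "diag_chain_mod q D"
  unfolding diag_chain_mod_def
proof (intro conjI allI impI)
  fix i j assume "i < dim_row D" "j < dim_col D" "i \<noteq> j"
  then show "[D $$ (i,j) = 0] (mod int q)"
    using D by (auto simp: smith_matrices_def diagonal_mat_def)
next
  fix i assume "Suc i < dim_col D"
  then have "D $$ (i,i) dvd D $$ (Suc i, Suc i)" using D by (auto simp: smith_matrices_def)
  then show "\<exists>c. [D $$ (Suc i, Suc i) = c * D $$ (i,i)] (mod int q)"
    by (metis cong_refl dvd_def mult.commute)
qed

lemma invertible_mat_imp_mod:
  assumes "invertible_mat P" "P \<in> carrier_mat n n"
  shows "invertible_mat_mod q P" "\<exists>B\<in>carrier_mat n n. P * B = 1\<^sub>m n \<and> B * P = 1\<^sub>m n"
proof -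
  obtain B where B: "P * B = 1\<^sub>m n" "B * P = 1\<^sub>m (dim_row B)"
    using assms unfolding invertible_mat_def inverts_mat_def by auto
  have "dim_col B = n" using arg_cong[OF B(1), of dim_col] by simp
  moreover have "dim_row B = n" using arg_cong[OF B(2), of dim_col] assms(2) by simp
  ultimately have Bc: "B \<in> carrier_mat n n" "B * P = 1\<^sub>m n" using B by auto
  then show "\<exists>B\<in>carrier_mat n n. P * B = 1\<^sub>m n \<and> B * P = 1\<^sub>m n" using B by blast
  show "invertible_mat_mod q P"
    unfolding invertible_mat_mod_def
  proof (intro conjI bexI)
    show "cong_mat q (P * B) (1\<^sub>m (dim_row P))" "cong_mat q (B * P) (1\<^sub>m (dim_row P))"
      using assms(2) B(1) Bc(2) by (simp_all add: cong_mat_refl)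
  qed (use assms(2) Bc(1) in auto)
qed

lemma is_snf_imp_is_snf_mod:
  assumes "is_snf M D" "dim_col M \<le> dim_row M"
  shows "is_snf_mod q M D"
  unfolding is_snf_mod_iff
proof (intro conjI)
  have D: "D \<in> smith_matrices (dim_row M) (dim_col M)" using assms by (simp add: is_snf_def)
  then show "D \<in> carrier_mat (dim_row M) (dim_col M)" by (simp add: smith_matrices_def)
  show "diag_chain_mod q D" using diag_chain_mod_smith_matrices[OF D assms(2)] .
  show "\<exists>P\<in>carrier_mat (dim_row M) (dim_row M). \<exists>Q\<in>carrier_mat (dim_col M) (dim_col M).
       invertible_mat_mod q P \<and> invertible_mat_mod q Q \<and> cong_mat q (P * M * Q) D"
    using assms(1) invertible_mat_imp_mod(1) cong_mat_refl unfolding is_snf_def by blast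
qed

section \<open>Local conditions for the integer Smith normal form\<close>

definition smith_with :: "nat \<Rightarrow> nat \<Rightarrow> nat \<Rightarrow> (nat \<Rightarrow> nat) \<Rightarrow> int mat set" where
  "smith_with n m r d = {D \<in> smith_matrices n m. \<forall>i<r. D $$ (i,i) = int (d i)}"

text \<open>
  The integer Smith form is also one modulo \<open>q\<close>, so uniqueness modulo prime powers compares it
  with the form witnessing membership; the units in that witness do not affect divisibility.
\<close>
lemma snf_in_mod_dvd_iff:
  assumes M: "M \<in> carrier_mat n m" "m \<le> n" and D: "is_snf M D"
    and S: "snf_in_mod q (smith_with n m r d) M" and p: "prime p" "p ^ a dvd q"
    and i: "i < r" "r \<le> m"
  shows "int p ^ a dvd D $$ (i,i) \<longleftrightarrow> p ^ a dvd d i"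
proof -
  obtain E D' where E: "is_snf_mod q M E" and D': "D' \<in> smith_with n m r d"
    and "\<forall>i<dim_col M. \<exists>u. coprime u (int q) \<and> [D' $$ (i,i) = u * E $$ (i,i)] (mod int q)"
    using S unfolding snf_in_mod_def by blast
  moreover have "i < dim_col M" using i M by simp
  ultimately obtain u where u: "coprime u (int q)" "[D' $$ (i,i) = u * E $$ (i,i)] (mod int q)"
    by blast
  have D_mod: "is_snf_mod q M D" using is_snf_imp_is_snf_mod[OF D] M by auto
  have pq: "int p ^ a dvd int q" using p by (metis of_nat_dvd_iff of_nat_power)
  have "int p ^ a dvd D $$ (i,i) \<longleftrightarrow> int p ^ a dvd E $$ (i,i)"
    using is_snf_mod_dvd_transfer[OF M D_mod E p, of i]
      is_snf_mod_dvd_transfer[OF M E D_mod p, of i] i by auto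
  also have "\<dots> \<longleftrightarrow> int p ^ a dvd u * E $$ (i,i)"
  proof -
    have "coprime (int p ^ a) u" using u(1) pq by (meson coprime_commute coprime_divisors dvd_refl)
    then show ?thesis by (simp add: coprime_dvd_mult_right_iff)
  qed
  also have "\<dots> \<longleftrightarrow> int p ^ a dvd D' $$ (i,i)"
    using cong_dvd_modulus[OF u(2) pq] cong_dvd_iff by blast
  also have "\<dots> \<longleftrightarrow> p ^ a dvd d i"
    using D' i by (simp add: smith_with_def) (metis of_nat_dvd_iff of_nat_power)
  finally show ?thesis .
qed

text \<open>
  Precision \<open>s p + 1\<close> suffices to read off a valuation that is known to be at most \<open>s p\<close>.
\<close>
lemma eq_of_prime_power_dvd_iff:
  fixes x y :: nat
  assumes y: "y \<noteq> 0" and s: "\<And>p. prime p \<Longrightarrow> \<not> p ^ Suc (s p) dvd y"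
    and iff: "\<And>p a. prime p \<Longrightarrow> a \<le> Suc (s p) \<Longrightarrow> p ^ a dvd x \<longleftrightarrow> p ^ a dvd y"
  shows "x = y"
proof -
  have "x \<noteq> 0" using s[OF two_is_prime_nat] iff[OF two_is_prime_nat order.refl]
    by (metis dvd_0_right)
  moreover have "multiplicity p x = multiplicity p y" if p: "prime p" for p
  proof -
    have "Suc (multiplicity p y) \<le> Suc (s p)"
      using s[OF p] y p by (metis Suc_le_mono not_less_eq_eq power_dvd_iff_le_multiplicity
          not_prime_unit)
    moreover have "\<not> p ^ Suc (multiplicity p y) dvd y"
      using y p by (metis not_less_eq_eq not_prime_unit order.refl power_dvd_iff_le_multiplicity)
    ultimately have "p ^ multiplicity p y dvd x" "\<not> p ^ Suc (multiplicity p y) dvd x"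
      using iff[OF p, of "Suc (multiplicity p y)"] iff[OF p, of "multiplicity p y"]
        multiplicity_dvd[of p y] by (simp_all del: power_Suc)
    then show ?thesis by (rule multiplicity_eqI)
  qed
  ultimately show ?thesis using y by (metis multiplicity_eq_nat neq0_conv)
qed

text \<open>
  From right to left, take any integer Smith form of \<open>M\<close>: the local conditions determine all
  valuations of its first \<open>r\<close> entries, and these entries are nonnegative.
\<close>
lemma exists_snf_in_smith_with_iff:
  assumes M: "M \<in> carrier_mat n m" "m \<le> n" and r: "r \<le> m"
    and d: "\<And>i. i < r \<Longrightarrow> d i \<noteq> 0"
    and s: "\<And>i p. i < r \<Longrightarrow> prime p \<Longrightarrow> \<not> p ^ Suc (s p) dvd d i"
  shows "(\<exists>D\<in>smith_with n m r d. is_snf M D) \<longleftrightarrow>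
    (\<forall>p. prime p \<longrightarrow> snf_in_mod (p ^ Suc (s p)) (smith_with n m r d) M)"
proof (intro iffI allI impI)
  fix p :: nat assume "\<exists>D\<in>smith_with n m r d. is_snf M D" "prime p"
  then obtain D where D: "D \<in> smith_with n m r d" "is_snf M D" by blast
  have "is_snf_mod (p ^ Suc (s p)) M D" using is_snf_imp_is_snf_mod[OF D(2)] M by simp
  moreover have "\<forall>i<dim_col M. \<exists>u. coprime u (int (p ^ Suc (s p))) \<and>
      [D $$ (i,i) = u * D $$ (i,i)] (mod int (p ^ Suc (s p)))"
    by (metis cong_refl coprime_1_left mult_1)
  ultimately show "snf_in_mod (p ^ Suc (s p)) (smith_with n m r d) M"
    using D(1) unfolding snf_in_mod_def by blast
next
  assume all: "\<forall>p. prime p \<longrightarrow> snf_in_mod (p ^ Suc (s p)) (smith_with n m r d) M"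
  obtain D where D: "is_snf M D" using exists_is_snf[OF M] by blast
  have Ds: "D \<in> smith_matrices n m" using D M by (simp add: is_snf_def)
  have "D $$ (i,i) = int (d i)" if i: "i < r" for i
  proof -
    have "0 \<le> D $$ (i,i)" using Ds i r by (auto simp: smith_matrices_def)
    then obtain x where x: "D $$ (i,i) = int x" using nonneg_int_cases by blast
    have "x = d i"
    proof (rule eq_of_prime_power_dvd_iff[of _ s])
      fix p a :: nat assume p: "prime p" "a \<le> Suc (s p)"
      have "int p ^ a dvd D $$ (i,i) \<longleftrightarrow> p ^ a dvd d i"
        using snf_in_mod_dvd_iff[OF M D all[rule_format, OF p(1)] p(1) le_imp_power_dvd[OF p(2)] i r] .
      then show "p ^ a dvd x \<longleftrightarrow> p ^ a dvd d i"
        by (simp add: x) (metis of_nat_dvd_iff of_nat_power)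
    qed (use d s i in auto)
    then show ?thesis using x by simp
  qed
  then show "\<exists>D\<in>smith_with n m r d. is_snf M D" using D Ds by (auto simp: smith_with_def)
qed

text \<open>
  At a prime not dividing any \<open>d i\<close> the local condition only asks for rank at least \<open>r\<close>. If the
  \<open>r\<close>-th invariant factor is prime to \<open>p\<close>, rescaling by units yields a suitable member \<open>D'\<close> of the
  set; otherwise the rank modulo \<open>p\<close> is smaller than \<open>r\<close>, so the first \<open>r\<close> columns are dependent.
\<close>
lemma cols_dependent_if_not_snf_in_mod:
  assumes M: "M \<in> carrier_mat n m" "m \<le> n" and r: "1 \<le> r" "r \<le> m" "a \<le> n"
    and d: "\<And>i. Suc i < r \<Longrightarrow> d i dvd d (Suc i)"
    and p: "prime p" "\<And>i. i < r \<Longrightarrow> \<not> p dvd d i"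
    and notin: "\<not> snf_in_mod p (smith_with n m r d) M"
  shows "cols_dependent_mod p a r (\<lambda>(i,j). M $$ (i,j))"
proof -
  obtain D where D: "is_snf M D" using exists_is_snf[OF M] by blast
  have Ds: "D \<in> smith_matrices n m" using D M by (simp add: is_snf_def)
  have Dc: "D \<in> carrier_mat n m" using Ds by (simp add: smith_matrices_def)
  have dvd: "int p dvd D $$ (r - 1, r - 1)"
  proof (rule ccontr)
    assume nd: "\<not> int p dvd D $$ (r - 1, r - 1)"
    \<comment> \<open>Entries from position \<open>r\<close> on are multiplied by the unit \<open>d (r - 1)\<close> in order to continue the
      divisibility chain.\<close>
    define D' where "D' = mat n m (\<lambda>(i,j). if i \<noteq> j then 0 else if i < r then int (d i)
      else int (d (r - 1)) * D $$ (i,i))"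
    have "D' \<in> smith_with n m r d"
    proof -
      have "D' $$ (i,i) dvd D' $$ (Suc i, Suc i)" if i: "Suc i < m" for i
      proof -
        consider "Suc i < r" | "i = r - 1" | "r \<le> i" by linarith
        then show ?thesis
          using i M(2) r(1) d[of i] smith_matrices_dvd_mono[OF Ds, of i "Suc i"]
          by cases (auto simp: D'_def)
      qed
      moreover have "0 \<le> D' $$ (i,i)" if i: "i < m" for i
        using i M(2) Ds by (auto simp: D'_def smith_matrices_def)
      ultimately show ?thesis
        using M(2) r by (auto simp: smith_with_def smith_matrices_def diagonal_mat_def D'_def)
    qed
    moreover have "\<exists>u. coprime u (int p) \<and> [D' $$ (i,i) = u * D $$ (i,i)] (mod int p)"
      if i: "i < m" for i
    proof (cases "i < r")
      case True
      have "\<not> int p dvd D $$ (i,i)"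
        using nd smith_matrices_dvd_mono[OF Ds, of i "r - 1"] True r by (auto intro: dvd_trans)
      then have "coprime (D $$ (i,i)) (int p)"
        using p(1) by (simp add: coprime_commute prime_imp_coprime)
      then obtain w where w: "[D $$ (i,i) * w = 1] (mod int p)"
        using cong_solve_coprime_int by blast
      have "coprime (w * int (d i)) (int p)"
      proof -
        have "coprime w (int p)"
          using w by (metis coprime_iff_invertible_int mult.commute)
        moreover have "coprime (int (d i)) (int p)"
          using p(1) p(2)[OF True] by (simp add: coprime_commute prime_imp_coprime)
        ultimately show ?thesis by simp
      qed
      moreover have "[D' $$ (i,i) = (w * int (d i)) * D $$ (i,i)] (mod int p)"
        using cong_scalar_left[OF cong_sym[OF w], of "int (d i)"] True i M(2)
        by (simp add: D'_def mult_ac)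
      ultimately show ?thesis by blast
    next
      case False
      have "coprime (int (d (r - 1))) (int p)"
        using p(1) p(2)[of "r - 1"] r by (simp add: coprime_commute prime_imp_coprime)
      moreover have "D' $$ (i,i) = int (d (r - 1)) * D $$ (i,i)"
        using False i M(2) by (simp add: D'_def)
      ultimately show ?thesis by (metis cong_refl)
    qed
    ultimately have "snf_in_mod p (smith_with n m r d) M"
      using is_snf_imp_is_snf_mod[OF D, of p] M unfolding snf_in_mod_def by (metis carrier_matD)
    then show False using notin by blast
  qed
  obtain P Q where PQ: "P \<in> carrier_mat n n" "Q \<in> carrier_mat m m" "P * M * Q = D"
    "invertible_mat P" "invertible_mat Q"
    using D M unfolding is_snf_def by auto
  obtain A where A: "A \<in> carrier_mat n n" "A * P = 1\<^sub>m n"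
    using invertible_mat_imp_mod(2)[OF PQ(4,1)] by blast
  obtain B where B: "B \<in> carrier_mat m m" "Q * B = 1\<^sub>m m"
    using invertible_mat_imp_mod(2)[OF PQ(5,2)] by blast
  have "A * (P * M * Q) * B = (A * P) * M * (Q * B)"
    using PQ(1,2) A(1) B(1) M(1)
    by (simp add: assoc_mult_mat[of _ n n _ n _ m] assoc_mult_mat[of _ n n _ m _ m]
        assoc_mult_mat[of _ n m _ m _ m])
  then have MD: "A * D * B = M" using A(2) B(2) PQ(3) M(1) by simp
  have "int p dvd D $$ (k,t)" if "k < n" "r - 1 \<le> t" "t < m" for k t
  proof (cases "k = t")
    case True
    then show ?thesis
      using dvd smith_matrices_dvd_mono[OF Ds that(2,3)] by (auto intro: dvd_trans)
  next
    case False
    then show ?thesis using that Ds by (auto simp: smith_matrices_def diagonal_mat_def)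
  qed
  moreover have "r - 1 < m" using r by simp
  ultimately obtain v :: "nat \<Rightarrow> int" where v: "\<exists>j<Suc (r - 1). \<not> int p dvd v j"
    "\<And>k. k < n \<Longrightarrow> int p dvd (\<Sum>l<Suc (r - 1). (A * D * B) $$ (k,l) * v l)"
    using low_rank_kernel[OF A(1) Dc B(1), of "r - 1" "int p"] p(1) by blast
  then show ?thesis
    unfolding cols_dependent_mod_def MD using r by (intro exI[of _ v]) auto
qed

section \<open>Conditional probability bounds for product distributions\<close>

text \<open>
  Fubini: fix the coordinates outside \<open>J\<close>, on which \<open>B\<close> depends, and bound the probability over
  the coordinates in \<open>J\<close> alone. Successive exposure of a column and of a row of a random matrix
  multiplies the two bounds in this way.
\<close>
lemma prob_Pi_pmf_conditional_bound:
  assumes I: "finite I" "J \<subseteq> I" and c: "0 \<le> c"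
    and indep: "\<And>g h. B (\<lambda>x. if x \<in> J then h x else g x) \<longleftrightarrow> B g"
    and bound: "\<And>g. B g \<Longrightarrow>
      measure_pmf.prob (Pi_pmf J dflt p) {h. A (\<lambda>x. if x \<in> J then h x else g x)} \<le> c"
  shows "measure_pmf.prob (Pi_pmf I dflt p) {f. B f \<and> A f}
    \<le> c * measure_pmf.prob (Pi_pmf I dflt p) {f. B f}"
proof -
  define P where "P = Pi_pmf J dflt p"
  define R where "R = Pi_pmf (I - J) dflt p"
  have fin: "finite J" "finite (I - J)" "J \<union> (I - J) = I" using I finite_subset by auto
  have split: "Pi_pmf I dflt p = map_pmf (\<lambda>(h,g) x. if x \<in> J then h x else g x) (pair_pmf P R)"
    using Pi_pmf_union[of J "I - J" dflt p] fin unfolding P_def R_def by simp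
  have em: "emeasure (Pi_pmf I dflt p) X
      = (\<integral>\<^sup>+g. emeasure P {h. (\<lambda>x. if x \<in> J then h x else g x) \<in> X} \<partial>R)" for X
  proof -
    have "emeasure (Pi_pmf I dflt p) X
        = (\<integral>\<^sup>+g. \<integral>\<^sup>+h. indicator X (\<lambda>x. if x \<in> J then h x else g x) \<partial>P \<partial>R)"
      unfolding split
      by (subst pair_commute_pmf) (simp add: pmf.map_comp o_def case_prod_unfold pair_pmf_def
          map_bind_pmf cong: if_cong)
    moreover have "(\<integral>\<^sup>+h. indicator X (\<lambda>x. if x \<in> J then h x else g x) \<partial>P)
        = emeasure P {h. (\<lambda>x. if x \<in> J then h x else g x) \<in> X}" for g
      using nn_integral_indicator[of "{h. (\<lambda>x. if x \<in> J then h x else g x) \<in> X}" "measure_pmf P"]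
      by (simp add: indicator_def)
    ultimately show ?thesis by simp
  qed
  have "ennreal (measure_pmf.prob (Pi_pmf I dflt p) {f. B f \<and> A f})
      = (\<integral>\<^sup>+g. emeasure P {h. B g \<and> A (\<lambda>x. if x \<in> J then h x else g x)} \<partial>R)"
    by (subst measure_pmf.emeasure_eq_measure[symmetric], subst em) (simp add: indep)
  also have "\<dots> \<le> (\<integral>\<^sup>+g. ennreal c * indicator {g. B g} g \<partial>R)"
    by (intro nn_integral_mono)
      (use bound in \<open>auto simp: P_def measure_pmf.emeasure_eq_measure indicator_def intro!: ennreal_leI\<close>)
  also have "\<dots> = ennreal c * (\<integral>\<^sup>+g. emeasure P {h. B g} \<partial>R)"
  proof -
    have "indicator {g. B g} g = emeasure P {h. B g}" for g
      using measure_pmf.emeasure_space_1[of P] by (cases "B g") auto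
    then show ?thesis by (simp add: nn_integral_cmult)
  qed
  also have "\<dots> = ennreal c * emeasure (Pi_pmf I dflt p) {f. B f}"
    by (subst em) (simp add: indep)
  also have "\<dots> = ennreal (c * measure_pmf.prob (Pi_pmf I dflt p) {f. B f})"
    using c by (simp add: measure_pmf.emeasure_eq_measure ennreal_mult)
  finally show ?thesis using c by (simp add: mult_nonneg_nonneg)
qed

lemma card_residue_class_box_le:
  assumes p: "0 < p" and T: "T \<subseteq> {- int k..int k}" "\<And>x y. x \<in> T \<Longrightarrow> y \<in> T \<Longrightarrow> int p dvd x - y"
  shows "real (card T) \<le> real (2 * k + 1) * (1 / real p + 1 / real (2 * k + 1))"
proof -
  have "inj_on (\<lambda>x. (x + int k) div int p) T"
  proof (rule inj_onI)
    fix x y assume xy: "x \<in> T" "y \<in> T" "(x + int k) div int p = (y + int k) div int p"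
    have "int p dvd (x + int k) - (y + int k)" using T(2)[OF xy(1,2)] by simp
    then have "(x + int k) mod int p = (y + int k) mod int p" by (simp add: mod_eq_dvd_iff)
    then have "x + int k = y + int k" using xy(3) by (metis mult_div_mod_eq)
    then show "x = y" by simp
  qed
  moreover have "(\<lambda>x. (x + int k) div int p) ` T \<subseteq> {0..int (2 * k div p)}"
  proof (rule image_subsetI)
    fix x assume "x \<in> T"
    then have x: "0 \<le> x + int k" "x + int k \<le> int (2 * k)" using T(1) by auto
    have "(x + int k) div int p \<le> int (2 * k) div int p" using x(2) p by (intro zdiv_mono1) auto
    then show "(x + int k) div int p \<in> {0..int (2 * k div p)}"
      using x(1) p by (simp add: zdiv_int pos_imp_zdiv_nonneg_iff)
  qed
  ultimately have "card T \<le> card {0..int (2 * k div p)}" by (intro card_inj_on_le) auto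
  then have "real (card T) \<le> real (2 * k div p) + 1" by simp
  also have "real (2 * k div p) \<le> real (2 * k) / real p" by (rule of_nat_div_le_of_nat)
  also have "real (2 * k) / real p \<le> real (2 * k + 1) / real p" by (intro divide_right_mono) auto
  finally have "real (card T) \<le> real (2 * k + 1) / real p + 1" by simp
  also have "\<dots> = real (2 * k + 1) * (1 / real p + 1 / real (2 * k + 1))"
    by (simp only: distrib_left times_divide_eq_right mult_1_right) simp
  finally show ?thesis .
qed

abbreviation uniform_box :: "nat \<Rightarrow> 'a set \<Rightarrow> ('a \<Rightarrow> int) pmf" where
  "uniform_box k I \<equiv> Pi_pmf I 0 (\<lambda>_. pmf_of_set {- int k..int k})"

text \<open>
  Once all other coordinates are fixed, \<open>h x0\<close> is confined to one residue class modulo \<open>p\<close>. The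
  second summand is the rounding error; it keeps the bound meaningful for \<open>p\<close> larger than the box.
\<close>
lemma prob_linear_congruence_le:
  assumes J: "finite J" "x0 \<in> J" and p: "prime p" and \<mu>: "\<not> int p dvd \<mu> x0"
  shows "measure_pmf.prob (uniform_box k J) {h. int p dvd (\<Sum>x\<in>J. h x * \<mu> x)}
    \<le> 1 / real p + 1 / real (2 * k + 1)"
proof -
  let ?U = "pmf_of_set {- int k..int k}" and ?c = "1 / real p + 1 / real (2 * k + 1)"
  have "measure_pmf.prob (Pi_pmf {x0} 0 (\<lambda>_. ?U))
      {h. int p dvd (\<Sum>x\<in>J. (if x \<in> {x0} then h x else g x) * \<mu> x)} \<le> ?c" for g :: "'a \<Rightarrow> int"
  proof -
    define T where "T = {y \<in> {- int k..int k}. int p dvd y * \<mu> x0 + (\<Sum>x\<in>J - {x0}. g x * \<mu> x)}"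
    have "measure_pmf.prob (Pi_pmf {x0} 0 (\<lambda>_. ?U))
        {h. int p dvd (\<Sum>x\<in>J. (if x \<in> {x0} then h x else g x) * \<mu> x)}
      = measure_pmf.prob ?U {y. int p dvd y * \<mu> x0 + (\<Sum>x\<in>J - {x0}. g x * \<mu> x)}"
    proof -
      have "(\<Sum>x\<in>J. (if x \<in> {x0} then y else g x) * \<mu> x)
          = y * \<mu> x0 + (\<Sum>x\<in>J - {x0}. g x * \<mu> x)" for y
        using J by (subst sum.remove[of J x0]) (auto intro!: sum.cong)
      then show ?thesis
        unfolding Pi_pmf_singleton measure_map_pmf
        by (intro arg_cong[of _ _ "measure_pmf.prob ?U"]) (auto cong: if_cong)
    qed
    also have "\<dots> = real (card T) / real (2 * k + 1)"
    proof -
      have "T = {- int k..int k} \<inter> {y. int p dvd y * \<mu> x0 + (\<Sum>x\<in>J - {x0}. g x * \<mu> x)}"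
        by (auto simp: T_def)
      then show ?thesis by (simp add: measure_pmf_of_set)
    qed
    also have "\<dots> \<le> ?c"
    proof -
      have "int p dvd x - y" if "x \<in> T" "y \<in> T" for x y
      proof -
        have "int p dvd (x * \<mu> x0 + (\<Sum>x\<in>J - {x0}. g x * \<mu> x))
            - (y * \<mu> x0 + (\<Sum>x\<in>J - {x0}. g x * \<mu> x))"
          using that by (intro dvd_diff) (auto simp: T_def)
        then have "int p dvd (x - y) * \<mu> x0" by (simp add: algebra_simps)
        then show ?thesis using p \<mu> by (simp add: prime_dvd_mult_iff)
      qed
      then have "real (card T) \<le> real (2 * k + 1) * ?c"
        using p prime_gt_0_nat by (intro card_residue_class_box_le) (auto simp: T_def)
      then show ?thesis by (simp add: pos_divide_le_eq mult.commute)
    qed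
    finally show ?thesis .
  qed
  then show ?thesis
    using prob_Pi_pmf_conditional_bound[of J "{x0}" ?c "\<lambda>_. True" 0 "\<lambda>_. ?U"
        "\<lambda>h. int p dvd (\<Sum>x\<in>J. h x * \<mu> x)"] J by simp
qed

section \<open>Random matrices are rarely degenerate modulo a large prime\<close>

lemma cols_dependent_mod_cong:
  "(\<And>i j. i < a \<Longrightarrow> j < b \<Longrightarrow> f (i,j) = g (i,j)) \<Longrightarrow>
    cols_dependent_mod p a b f \<longleftrightarrow> cols_dependent_mod p a b g"
  unfolding cols_dependent_mod_def by (intro ex_cong1) auto

lemma cols_dependent_mod_rows_mono:
  "cols_dependent_mod p a b f \<Longrightarrow> a' \<le> a \<Longrightarrow> cols_dependent_mod p a' b f"
  unfolding cols_dependent_mod_def by (meson less_le_trans)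

lemma last_coeff_nonzero:
  assumes "\<not> cols_dependent_mod p a r f" "\<exists>j<Suc r. \<not> int p dvd v j"
    and "\<forall>i<a. int p dvd (\<Sum>j<Suc r. f (i,j) * v j)"
  shows "\<not> int p dvd v r"
proof
  assume pv: "int p dvd v r"
  have "int p dvd (\<Sum>j<r. f (i,j) * v j)" if "i < a" for i
    using assms(3)[rule_format, OF that] pv by (simp add: dvd_add_left_iff)
  moreover have "\<exists>j<r. \<not> int p dvd v j" using assms(2) pv less_Suc_eq by auto
  ultimately show False using assms(1) unfolding cols_dependent_mod_def by blast
qed

text \<open>
  Exposing column \<open>r\<close> of a square block whose earlier columns are independent modulo \<open>p\<close>. A vector
  \<open>w\<close> orthogonal to the earlier columns exists over the integers, and primitive; if the new column
  depends on them, it must be orthogonal to \<open>w\<close> modulo \<open>p\<close>.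
\<close>
lemma prob_dependent_column_le:
  assumes I: "finite I" "{..<Suc r} \<times> {..<Suc r} \<subseteq> I" and p: "prime p"
  shows "measure_pmf.prob (uniform_box k I)
      {f. \<not> cols_dependent_mod p (Suc r) r f \<and> cols_dependent_mod p (Suc r) (Suc r) f}
    \<le> 1 / real p + 1 / real (2 * k + 1)"
proof -
  let ?A = "\<lambda>f. \<not> cols_dependent_mod p (Suc r) r f \<and> cols_dependent_mod p (Suc r) (Suc r) f"
  define J where "J = {..<Suc r} \<times> {r}"
  have J: "finite J" "J \<subseteq> I" using I by (auto simp: J_def)
  have "measure_pmf.prob (uniform_box k J) {h. ?A (\<lambda>x. if x \<in> J then h x else g x)}
      \<le> 1 / real p + 1 / real (2 * k + 1)" for g
  proof -
    obtain w where w: "\<forall>p::nat. prime p \<longrightarrow> (\<exists>i<Suc r. \<not> int p dvd w i)"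
      "\<forall>j<r. (\<Sum>i<Suc r. g (i,j) * w i) = 0"
      using primitive_kernel_underdetermined[of r "\<lambda>j i. g (i,j)"] by blast
    obtain i0 where i0: "i0 < Suc r" "\<not> int p dvd w i0" using w(1) p by blast
    have "int p dvd (\<Sum>x\<in>J. h x * w (fst x))" if h: "?A (\<lambda>x. if x \<in> J then h x else g x)" for h
    proof -
      define f where "f = (\<lambda>x. if x \<in> J then h x else g x)"
      obtain v where v: "\<exists>j<Suc r. \<not> int p dvd v j"
        "\<forall>i<Suc r. int p dvd (\<Sum>j<Suc r. f (i,j) * v j)"
        using h unfolding f_def[symmetric] cols_dependent_mod_def[of p "Suc r" "Suc r"] by blast
      have vr: "\<not> int p dvd v r" using h v last_coeff_nonzero unfolding f_def[symmetric] by blast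
      have "(\<Sum>i<Suc r. w i * (\<Sum>j<Suc r. f (i,j) * v j))
          = (\<Sum>j<Suc r. (\<Sum>i<Suc r. f (i,j) * w i) * v j)"
        by (simp only: sum_distrib_left sum_distrib_right) (subst sum.swap, simp only: mult_ac)
      also have "\<dots> = (\<Sum>i<Suc r. f (i,r) * w i) * v r"
      proof -
        have "(\<Sum>i<Suc r. f (i,j) * w i) = 0" if "j < r" for j
          using w(2) that by (simp add: f_def J_def)
        then show ?thesis by simp
      qed
      finally have "int p dvd (\<Sum>i<Suc r. f (i,r) * w i) * v r"
        using v(2) by (metis (no_types, lifting) dvd_mult dvd_sum lessThan_iff)
      then have "int p dvd (\<Sum>i<Suc r. f (i,r) * w i)"
        using vr p by (simp add: prime_dvd_mult_iff)
      also have "(\<Sum>i<Suc r. f (i,r) * w i) = (\<Sum>x\<in>J. h x * w (fst x))"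
        by (rule sum.reindex_bij_witness[of _ fst "\<lambda>i. (i,r)"]) (auto simp: J_def f_def)
      finally show ?thesis .
    qed
    then have "measure_pmf.prob (uniform_box k J) {h. ?A (\<lambda>x. if x \<in> J then h x else g x)}
        \<le> measure_pmf.prob (uniform_box k J) {h. int p dvd (\<Sum>x\<in>J. h x * w (fst x))}"
      by (intro measure_pmf.finite_measure_mono) auto
    also have "\<dots> \<le> 1 / real p + 1 / real (2 * k + 1)"
      by (rule prob_linear_congruence_le[OF J(1), of "(i0,r)"]) (use i0 p in \<open>auto simp: J_def\<close>)
    finally show ?thesis .
  qed
  then show ?thesis
    using prob_Pi_pmf_conditional_bound[of I J "1 / real p + 1 / real (2 * k + 1)" "\<lambda>_. True" 0
        "\<lambda>_. pmf_of_set {- int k..int k}" ?A] I(1) J(2) by simp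
qed

text \<open>
  Exposing one more row. As the first \<open>r\<close> columns are independent, the relations between all \<open>r + 1\<close>
  columns form a space of dimension at most one modulo \<open>p\<close>, so a single relation \<open>w\<close>, fixed before
  the row is known, tests every row.
\<close>
lemma prob_dependent_row_le:
  fixes g :: "nat \<times> nat \<Rightarrow> int"
  assumes p: "prime p" and g: "\<not> cols_dependent_mod p (Suc r) r g" and J: "J = {Suc r} \<times> {..<Suc r}"
  shows "measure_pmf.prob (uniform_box k J)
      {h. cols_dependent_mod p (Suc (Suc r)) (Suc r) (\<lambda>x. if x \<in> J then h x else g x)}
    \<le> 1 / real p + 1 / real (2 * k + 1)"
proof -
  let ?m = "\<lambda>h x. if x \<in> J then h x else g x"
  define K where "K h v \<longleftrightarrow> (\<exists>j<Suc r. \<not> int p dvd v j) \<and>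
    (\<forall>i<Suc r. int p dvd (\<Sum>j<Suc r. g (i,j) * v j)) \<and> int p dvd (\<Sum>j<Suc r. h (Suc r, j) * v j)"
    for h :: "nat \<times> nat \<Rightarrow> int" and v :: "nat \<Rightarrow> int"
  have K: "\<exists>v. K h v" if "cols_dependent_mod p (Suc (Suc r)) (Suc r) (?m h)" for h
  proof -
    obtain v where v: "\<exists>j<Suc r. \<not> int p dvd v j"
      "\<forall>i<Suc (Suc r). int p dvd (\<Sum>j<Suc r. ?m h (i,j) * v j)"
      using \<open>cols_dependent_mod _ _ _ _\<close> unfolding cols_dependent_mod_def by blast
    have "int p dvd (\<Sum>j<Suc r. g (i,j) * v j)" if "i < Suc r" for i
    proof -
      have "(\<Sum>j<Suc r. g (i,j) * v j) = (\<Sum>j<Suc r. ?m h (i,j) * v j)"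
        using that by (intro sum.cong) (auto simp: J)
      then show ?thesis using v(2) that by simp
    qed
    moreover have "(\<Sum>j<Suc r. h (Suc r,j) * v j) = (\<Sum>j<Suc r. ?m h (Suc r,j) * v j)"
      by (intro sum.cong) (auto simp: J)
    ultimately show ?thesis using v unfolding K_def by auto
  qed
  show ?thesis
  proof (cases "\<exists>h v. K h v")
    case False
    then have "{h. cols_dependent_mod p (Suc (Suc r)) (Suc r) (?m h)} = {}" using K by blast
    then show ?thesis by simp
  next
    case True
    then obtain h0 w where w: "K h0 w" by blast
    have wr: "\<not> int p dvd w r" using w g last_coeff_nonzero unfolding K_def by blast
    have "int p dvd (\<Sum>x\<in>J. h x * w (snd x))"
      if "cols_dependent_mod p (Suc (Suc r)) (Suc r) (?m h)" for h
    proof -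
      obtain v where v: "K h v" using K \<open>cols_dependent_mod _ _ _ _\<close> by blast
      have vr: "\<not> int p dvd v r" using v g last_coeff_nonzero unfolding K_def by blast
      \<comment> \<open>The combination that cancels the last coefficient; independence of the first \<open>r\<close> columns
        forces it to vanish modulo \<open>p\<close>.\<close>
      define u where "u j = v r * w j - w r * v j" for j
      have u_sum: "(\<Sum>j<Suc r. a j * u j)
          = v r * (\<Sum>j<Suc r. a j * w j) - w r * (\<Sum>j<Suc r. a j * v j)" for a :: "nat \<Rightarrow> int"
        by (simp only: u_def sum_distrib_left sum_subtractf[symmetric]) (simp add: algebra_simps)
      have u_ker: "int p dvd (\<Sum>j<Suc r. g (i,j) * u j)" if "i < Suc r" for i
        unfolding u_sum using v w that by (auto simp: K_def intro!: dvd_diff dvd_mult)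
      have ur: "u r = 0" by (simp add: u_def)
      have u0: "int p dvd u j" if "j < Suc r" for j
        using last_coeff_nonzero[OF g, of u] u_ker ur that by auto
      have "int p dvd (\<Sum>j<Suc r. h (Suc r,j) * u j)" using u0 by (auto intro!: dvd_sum dvd_mult simp del: sum.lessThan_Suc)
      then have "int p dvd v r * (\<Sum>j<Suc r. h (Suc r,j) * w j) - w r * (\<Sum>j<Suc r. h (Suc r,j) * v j)"
        by (simp only: u_sum)
      moreover have "int p dvd w r * (\<Sum>j<Suc r. h (Suc r,j) * v j)"
        using v by (auto simp: K_def simp del: sum.lessThan_Suc)
      ultimately have "int p dvd v r * (\<Sum>j<Suc r. h (Suc r,j) * w j)"
        by (metis dvd_diffD1 dvd_diff_commute diff_0_right dvd_add_right_iff diff_add_cancel)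
      then have "int p dvd (\<Sum>j<Suc r. h (Suc r,j) * w j)"
        using vr p by (metis prime_dvd_mult_iff prime_nat_int_transfer)
      also have "(\<Sum>j<Suc r. h (Suc r,j) * w j) = (\<Sum>x\<in>J. h x * w (snd x))"
        by (rule sum.reindex_bij_witness[of _ snd "\<lambda>j. (Suc r,j)"]) (auto simp: J)
      finally show ?thesis .
    qed
    then have "measure_pmf.prob (uniform_box k J)
          {h. cols_dependent_mod p (Suc (Suc r)) (Suc r) (?m h)}
        \<le> measure_pmf.prob (uniform_box k J) {h. int p dvd (\<Sum>x\<in>J. h x * w (snd x))}"
      by (intro measure_pmf.finite_measure_mono) auto
    also have "\<dots> \<le> 1 / real p + 1 / real (2 * k + 1)"
      by (rule prob_linear_congruence_le[of J "(Suc r,r)"]) (use wr p in \<open>auto simp: J\<close>)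
    finally show ?thesis .
  qed
qed

lemma abs_det_le:
  fixes f :: "nat \<times> nat \<Rightarrow> int"
  assumes "\<And>i j. i < b \<Longrightarrow> j < b \<Longrightarrow> \<bar>f (i,j)\<bar> \<le> int k"
  shows "\<bar>det (mat b b f)\<bar> \<le> int (fact b * k ^ b)"
proof -
  have "\<bar>det (mat b b f)\<bar>
      = \<bar>\<Sum>p\<in>{p. p permutes {0..<b}}. signof p * (\<Prod>i = 0..<b. mat b b f $$ (i, p i))\<bar>"
    by (subst det_def'[of _ b]) simp_all
  also have "\<dots> \<le> (\<Sum>p\<in>{p. p permutes {0..<b}}. \<bar>signof p * (\<Prod>i = 0..<b. mat b b f $$ (i, p i))\<bar>)"
    by (rule sum_abs)
  also have "\<dots> \<le> (\<Sum>p\<in>{p. p permutes {0..<b}}. int k ^ b)"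
  proof (rule sum_mono)
    fix p assume "p \<in> {p. p permutes {0..<b}}"
    then have p: "p permutes {0..<b}" by simp
    have "\<bar>signof p * (\<Prod>i = 0..<b. mat b b f $$ (i, p i))\<bar>
        = (\<Prod>i = 0..<b. \<bar>mat b b f $$ (i, p i)\<bar>)"
      by (simp add: abs_mult abs_prod sign_def)
    also have "\<dots> \<le> (\<Prod>i = 0..<b. int k)"
      using assms permutes_in_image[OF p] by (intro prod_mono) auto
    finally show "\<bar>signof p * (\<Prod>i = 0..<b. mat b b f $$ (i, p i))\<bar> \<le> int k ^ b" by simp
  qed
  also have "\<dots> = int (fact b * k ^ b)" by (simp add: card_permutations)
  finally show ?thesis .
qed

text \<open>
  The product of the primes in \<open>T\<close> divides \<open>x\<close> and exceeds \<open>k ^ card T\<close> unless \<open>T\<close> is empty.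
\<close>
lemma card_prime_divisors_le:
  fixes x :: int
  assumes x: "x \<noteq> 0" "\<bar>x\<bar> \<le> int k ^ e" and k: "1 < k"
    and T: "\<And>p. p \<in> T \<Longrightarrow> prime p \<and> k < p \<and> int p dvd x"
  shows "finite T" "card T \<le> e"
proof -
  have "T \<subseteq> prime_factors (nat \<bar>x\<bar>)"
    using T x(1) by (auto simp: prime_factors_dvd int_dvd_int_iff[symmetric] simp del: int_dvd_int_iff)
  then show fin: "finite T" using finite_subset by blast
  have "int (\<Prod>T) dvd x"
    using fin T
  proof (induction T rule: finite_induct)
    case (insert p T)
    have "coprime p q" if "q \<in> T" for q
      using insert that by (metis insertCI primes_coprime)
    then have "coprime (int p) (int (\<Prod>T))" by (simp add: prod_coprime_right)
    then have "int p * int (\<Prod>T) dvd x" using insert by (intro divides_mult) auto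
    then show ?case using insert by simp
  qed simp
  then have "int (\<Prod>T) \<le> \<bar>x\<bar>" using x(1) by (metis dvd_abs_iff zdvd_imp_le zero_less_abs_iff)
  moreover have "k ^ card T \<le> \<Prod>T"
    using prod_mono[of T "\<lambda>_. k" "\<lambda>p. p"] T fin by (simp add: less_imp_le)
  then have "int (k ^ card T) \<le> int (\<Prod>T)" by (simp only: of_nat_le_iff)
  ultimately have "int (k ^ card T) \<le> int (k ^ e)" using x(2) by simp
  then have "k ^ card T \<le> k ^ e" by (simp only: of_nat_le_iff)
  then show "card T \<le> e" using k by simp
qed

text \<open>
  One row more than columns: then dependence modulo \<open>p\<close> is a condition of codimension two. For
  \<open>p\<close> within the size of the box its probability is of order \<open>1 / p ^ 2\<close>, which is summable.
\<close>
definition degenerate :: "nat \<Rightarrow> nat \<Rightarrow> (nat \<times> nat \<Rightarrow> int) \<Rightarrow> bool" where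
  "degenerate r N f \<longleftrightarrow> (\<exists>p. prime p \<and> N < p \<and> cols_dependent_mod p (Suc r) r f)"

lemma sum_inverse_squares_le:
  assumes "1 \<le> N" "N \<le> k"
  shows "(\<Sum>p\<in>{N<..k}. 1 / real p ^ 2) \<le> 1 / real N - 1 / real k"
  using assms(2)
proof (induction k rule: dec_induct)
  case (step k)
  have "{N<..Suc k} = insert (Suc k) {N<..k}" using step by auto
  then have "(\<Sum>p\<in>{N<..Suc k}. 1 / real p ^ 2)
      = 1 / real (Suc k) ^ 2 + (\<Sum>p\<in>{N<..k}. 1 / real p ^ 2)" by simp
  also have "\<dots> \<le> 1 / real (Suc k) ^ 2 + (1 / real N - 1 / real k)" using step by simp
  also have "1 / real (Suc k) ^ 2 \<le> 1 / (real k * real (Suc k))"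
    using step assms(1) by (intro divide_left_mono) (auto simp: power2_eq_square)
  also have "1 / (real k * real (Suc k)) = 1 / real k - 1 / real (Suc k)"
    using step assms(1) by (simp add: field_simps)
  finally show ?case by simp
qed simp

lemma uniform_box_support:
  assumes "finite I" "f \<in> set_pmf (uniform_box k I)"
  shows "x \<in> I \<Longrightarrow> \<bar>f x\<bar> \<le> int k"
proof -
  assume "x \<in> I"
  have "f x \<in> set_pmf (pmf_of_set {- int k..int k})"
    using set_Pi_pmf_subset'[OF assms(1), of 0 "\<lambda>_. pmf_of_set {- int k..int k}"] assms(2) \<open>x \<in> I\<close>
    by (auto simp: PiE_dflt_def)
  then show ?thesis by (auto simp: set_pmf_of_set)
qed

text \<open>
  For primes up to the size \<open>k\<close> of the box, both the new column and the new row contribute a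
  factor of at most \<open>2 / p\<close>, and the union bound over the primes converges.
\<close>
lemma prob_medium_primes_le:
  assumes I: "finite I" "{..<Suc (Suc r)} \<times> {..<Suc r} \<subseteq> I" and N: "1 \<le> N"
  shows "measure_pmf.prob (uniform_box k I) {f. \<exists>p. prime p \<and> N < p \<and> p \<le> k \<and>
      \<not> cols_dependent_mod p (Suc r) r f \<and> cols_dependent_mod p (Suc (Suc r)) (Suc r) f} \<le> 4 / real N"
proof -
  let ?P = "measure_pmf.prob (uniform_box k I)"
  let ?c = "\<lambda>p. 1 / real p + 1 / real (2 * k + 1)"
  let ?B = "\<lambda>p f. \<not> cols_dependent_mod p (Suc r) r f \<and> cols_dependent_mod p (Suc r) (Suc r) f"
  define A where "A p = {f. ?B p f \<and> cols_dependent_mod p (Suc (Suc r)) (Suc r) f}" for p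
  define J where "J = {Suc r} \<times> {..<Suc r}"
  define T where "T = {p. prime p \<and> N < p \<and> p \<le> k}"
  have T: "finite T" "T \<subseteq> {N<..k}" by (auto simp: T_def)
  have I': "{..<Suc r} \<times> {..<Suc r} \<subseteq> I" using I(2) by auto
  have PA: "?P (A p) \<le> 4 * (1 / real p ^ 2)" if p: "p \<in> T" for p
  proof -
    have p': "prime p" "p \<le> k" "0 < p" using p by (auto simp: T_def prime_gt_0_nat)
    have c: "0 \<le> ?c p" "?c p \<le> 2 / real p"
      using frac_le[of 1 1 "real p" "real (2 * k + 1)"] p' by auto
    have "?P (A p) \<le> ?c p * ?P {f. ?B p f}"
      unfolding A_def
    proof (rule prob_Pi_pmf_conditional_bound[where J = J])
      show "J \<subseteq> I" using I by (auto simp: J_def)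
      show "?B p (\<lambda>x. if x \<in> J then h x else g x) \<longleftrightarrow> ?B p g" for g h
      proof -
        have "cols_dependent_mod p (Suc r) b (\<lambda>x. if x \<in> J then h x else g x)
            \<longleftrightarrow> cols_dependent_mod p (Suc r) b g" for b
          by (rule cols_dependent_mod_cong) (auto simp: J_def)
        then show ?thesis by simp
      qed
    qed (use I c p' prob_dependent_row_le J_def in auto)
    also have "\<dots> \<le> ?c p * ?c p"
      using c(1) prob_dependent_column_le[OF I(1) I' p'(1), of k] by (intro mult_left_mono)
    also have "\<dots> \<le> (2 / real p) * (2 / real p)" using c by (intro mult_mono) auto
    finally show ?thesis by (simp add: power2_eq_square)
  qed
  have "{f. \<exists>p. prime p \<and> N < p \<and> p \<le> k \<and> \<not> cols_dependent_mod p (Suc r) r f \<and>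
      cols_dependent_mod p (Suc (Suc r)) (Suc r) f} \<subseteq> (\<Union>p\<in>T. A p)"
    using cols_dependent_mod_rows_mono[where a = "Suc (Suc r)" and a' = "Suc r" and b = "Suc r"]
    unfolding T_def A_def by auto
  then have "?P {f. \<exists>p. prime p \<and> N < p \<and> p \<le> k \<and> \<not> cols_dependent_mod p (Suc r) r f \<and>
      cols_dependent_mod p (Suc (Suc r)) (Suc r) f} \<le> ?P (\<Union>p\<in>T. A p)"
    by (intro measure_pmf.finite_measure_mono) auto
  also have "\<dots> \<le> (\<Sum>p\<in>T. ?P (A p))"
    by (intro measure_pmf.finite_measure_subadditive_finite T(1)) auto
  also have "\<dots> \<le> (\<Sum>p\<in>T. 4 * (1 / real p ^ 2))" by (intro sum_mono PA)
  also have "\<dots> \<le> (\<Sum>p\<in>{N<..k}. 4 * (1 / real p ^ 2))" using T by (intro sum_mono2) auto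
  also have "\<dots> = 4 * (\<Sum>p\<in>{N<..k}. 1 / real p ^ 2)" by (simp add: sum_distrib_left)
  also have "\<dots> \<le> 4 * (1 / real N)"
  proof (cases "N \<le> k")
    case True
    then show ?thesis using sum_inverse_squares_le[OF N True] by (smt (verit) of_nat_0_le_iff divide_nonneg_nonneg)
  next
    case False
    then have "{N<..k} = {}" by auto
    then show ?thesis by simp
  qed
  finally show ?thesis by simp
qed

text \<open>
  For primes above \<open>k\<close> the union bound fails, as the bound for a single prime no longer decreases
  when \<open>p\<close> grows. But dependence requires that \<open>p\<close> divides the determinant of the square block,
  which is known before the last row: at most \<open>r + 2\<close> primes are left to be tested by that row.
\<close>
lemma prob_large_primes_le:
  assumes I: "finite I" "{..<Suc (Suc r)} \<times> {..<Suc r} \<subseteq> I" and k: "fact (Suc r) \<le> k" "1 < k"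
  shows "measure_pmf.prob (uniform_box k I) {f. det (mat (Suc r) (Suc r) f) \<noteq> 0 \<and>
      (\<exists>p. prime p \<and> k < p \<and> \<not> cols_dependent_mod p (Suc r) r f \<and>
        cols_dependent_mod p (Suc (Suc r)) (Suc r) f)} \<le> real (r + 2) * (2 / real k)"
    (is "measure_pmf.prob ?M {f. ?D f \<noteq> 0 \<and> (\<exists>p. prime p \<and> k < p \<and> ?R p f)} \<le> _")
proof -
  let ?b = "{..<Suc r} \<times> {..<Suc r}"
  define J where "J = {Suc r} \<times> {..<Suc r}"
  define B where "B f \<longleftrightarrow> (\<forall>x\<in>?b. \<bar>f x\<bar> \<le> int k) \<and> ?D f \<noteq> 0" for f
  define A where "A f \<longleftrightarrow> (\<exists>p. prime p \<and> k < p \<and> ?R p f)" for f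
  have I': "?b \<subseteq> I" using I(2) by auto
  have "measure_pmf.prob ?M {f. ?D f \<noteq> 0 \<and> A f}
      = measure_pmf.prob ?M ({f. ?D f \<noteq> 0 \<and> A f} \<inter> set_pmf ?M)"
    by (simp add: measure_Int_set_pmf)
  also have "\<dots> \<le> measure_pmf.prob ?M {f. B f \<and> A f}"
    using uniform_box_support[OF I(1)] I' 
    by (intro measure_pmf.finite_measure_mono) (auto simp: B_def)
  also have "\<dots> \<le> (real (r + 2) * (2 / real k)) * measure_pmf.prob ?M {f. B f}"
  proof (rule prob_Pi_pmf_conditional_bound[where J = J])
    fix g h :: "nat \<times> nat \<Rightarrow> int"
    let ?m = "\<lambda>x. if x \<in> J then h x else g x"
    have "mat (Suc r) (Suc r) ?m = mat (Suc r) (Suc r) g" by (rule eq_matI) (auto simp: J_def)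
    then show "B ?m \<longleftrightarrow> B g" by (auto simp: B_def J_def)
  next
    fix g :: "nat \<times> nat \<Rightarrow> int" assume g: "B g"
    let ?m = "\<lambda>h x. if x \<in> J then h x else g x"
    let ?Q = "measure_pmf.prob (uniform_box k J)"
    define T where "T = {p. prime p \<and> k < p \<and> int p dvd ?D g \<and> \<not> cols_dependent_mod p (Suc r) r g}"
    have "\<bar>?D g\<bar> \<le> int (fact (Suc r) * k ^ Suc r)"
      using g by (intro abs_det_le) (auto simp: B_def)
    also have "\<dots> \<le> int (k * k ^ Suc r)" using k(1) by (simp only: of_nat_le_iff mult_right_mono)
    finally have D: "\<bar>?D g\<bar> \<le> int k ^ (r + 2)" by simp
    have T: "finite T" "card T \<le> r + 2"
      using card_prime_divisors_le[of "?D g" k "r + 2" T] D g k(2) by (auto simp: B_def T_def)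
    define C where "C p = {h. cols_dependent_mod p (Suc (Suc r)) (Suc r) (?m h)}" for p
    have C: "?Q (C p) \<le> 2 / real k" if "p \<in> T" for p
    proof -
      have p: "prime p" "k < p" "\<not> cols_dependent_mod p (Suc r) r g" using that by (auto simp: T_def)
      have "?Q (C p) \<le> 1 / real p + 1 / real (2 * k + 1)"
        unfolding C_def by (rule prob_dependent_row_le[OF p(1,3) J_def])
      also have "\<dots> \<le> 1 / real k + 1 / real k"
        using p(2) k by (intro add_mono frac_le) auto
      finally show ?thesis by simp
    qed
    have "{h. A (?m h)} \<subseteq> (\<Union>p\<in>T. C p)"
    proof
      fix h assume "h \<in> {h. A (?m h)}"
      then obtain p where p: "prime p" "k < p" "\<not> cols_dependent_mod p (Suc r) r (?m h)"
        "cols_dependent_mod p (Suc (Suc r)) (Suc r) (?m h)" by (auto simp: A_def)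
      have eq: "cols_dependent_mod p (Suc r) b (?m h) \<longleftrightarrow> cols_dependent_mod p (Suc r) b g" for b
        by (rule cols_dependent_mod_cong) (auto simp: J_def)
      have "cols_dependent_mod p (Suc r) (Suc r) g"
        using cols_dependent_mod_rows_mono[OF p(4), of "Suc r"] eq by simp
      then have "int p dvd ?D g" by (rule cols_dependent_mod_dvd_det[OF p(1)])
      then show "h \<in> (\<Union>p\<in>T. C p)" using p eq by (auto simp: T_def C_def)
    qed
    then have "?Q {h. A (?m h)} \<le> ?Q (\<Union>p\<in>T. C p)"
      by (intro measure_pmf.finite_measure_mono) auto
    also have "\<dots> \<le> (\<Sum>p\<in>T. ?Q (C p))"
      by (intro measure_pmf.finite_measure_subadditive_finite T(1)) auto
    also have "\<dots> \<le> (\<Sum>p\<in>T. 2 / real k)" by (intro sum_mono C)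
    also have "\<dots> = real (card T) * (2 / real k)" by simp
    also have "\<dots> \<le> real (r + 2) * (2 / real k)" using T(2) by (intro mult_right_mono) auto
    finally show "?Q {h. A (?m h)} \<le> real (r + 2) * (2 / real k)" .
  qed (use I J_def in auto)
  also have "\<dots> \<le> real (r + 2) * (2 / real k)"
    by (rule mult_left_le) auto
  finally show ?thesis by (simp only: A_def)
qed

text \<open>
  Exposing column \<open>r\<close> and row \<open>r + 1\<close>. The determinant of the square block may vanish, but then its
  columns are dependent modulo every prime, in particular modulo one fixed prime \<open>q > N\<close>; when
  its earlier columns are independent modulo \<open>q\<close>, this has probability at most \<open>2 / N\<close>.
  The three contributions to \<open>7 / N\<close> are \<open>4 / N\<close> from the primes up to \<open>k\<close>, \<open>2 / N\<close> from a zero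
  determinant and \<open>1 / N\<close> from the primes above \<open>k\<close>.
\<close>
lemma prob_degenerate_step:
  assumes I: "finite I" "{..<Suc (Suc r)} \<times> {..<Suc r} \<subseteq> I" and N: "1 \<le> N"
  shows "\<forall>\<^sub>F k in sequentially. measure_pmf.prob (uniform_box k I) {f. degenerate (Suc r) N f}
    \<le> measure_pmf.prob (uniform_box k I) {f. degenerate r N f} + 7 / real N"
proof -
  obtain q where q: "prime q" "N < q" using bigger_prime by blast
  have I': "{..<Suc r} \<times> {..<Suc r} \<subseteq> I" using I(2) by auto
  have "\<forall>\<^sub>F k in sequentially. q \<le> k \<and> fact (Suc r) \<le> k \<and> 2 * N * (r + 2) \<le> k \<and> 1 < k"
    by (intro eventually_conj eventually_ge_at_top eventually_gt_at_top)
  then show ?thesis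
  proof (rule eventually_mono)
    fix k assume k: "q \<le> k \<and> fact (Suc r) \<le> k \<and> 2 * N * (r + 2) \<le> k \<and> 1 < k"
    let ?M = "uniform_box k I"
    let ?P = "measure_pmf.prob ?M"
    let ?R = "\<lambda>p f. \<not> cols_dependent_mod p (Suc r) r f \<and> cols_dependent_mod p (Suc (Suc r)) (Suc r) f"
    define X0 where "X0 = {f. degenerate r N f}"
    define X1 where "X1 = {f. \<exists>p. prime p \<and> N < p \<and> p \<le> k \<and> ?R p f}"
    define X2 where "X2 = {f. \<not> cols_dependent_mod q (Suc r) r f \<and> cols_dependent_mod q (Suc r) (Suc r) f}"
    define X3 where "X3 = {f. det (mat (Suc r) (Suc r) f) \<noteq> 0 \<and> (\<exists>p. prime p \<and> k < p \<and> ?R p f)}"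
    have "f \<in> X0 \<union> X1 \<union> X2 \<union> X3" if deg: "degenerate (Suc r) N f" for f
    proof (rule ccontr)
      assume f: "f \<notin> X0 \<union> X1 \<union> X2 \<union> X3"
      obtain p where p: "prime p" "N < p" "cols_dependent_mod p (Suc (Suc r)) (Suc r) f"
        using deg unfolding degenerate_def by blast
      have nd: "\<not> cols_dependent_mod p' (Suc r) r f" if "prime p'" "N < p'" for p'
        using f that unfolding X0_def degenerate_def by blast
      have "k < p" using f p nd unfolding X1_def by (auto simp: not_le[symmetric])
      then have "det (mat (Suc r) (Suc r) f) = 0" using f p nd unfolding X3_def by blast
      from primitive_kernel_of_det_0[OF mat_carrier this] obtain v :: "nat \<Rightarrow> int" where
        v: "\<exists>j<Suc r. \<not> int q dvd v j"
          "\<forall>i<Suc r. (\<Sum>j<Suc r. mat (Suc r) (Suc r) f $$ (i,j) * v j) = 0"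
        using q(1) by blast
      have "(\<Sum>j<Suc r. f (i,j) * v j) = (\<Sum>j<Suc r. mat (Suc r) (Suc r) f $$ (i,j) * v j)"
        if "i < Suc r" for i using that by (intro sum.cong) auto
      then have "cols_dependent_mod q (Suc r) (Suc r) f"
        unfolding cols_dependent_mod_def using v by (intro exI[of _ v]) (metis dvd_0_right)
      then show False using f nd[OF q] unfolding X2_def by blast
    qed
    then have "?P {f. degenerate (Suc r) N f} \<le> ?P (X0 \<union> X1 \<union> X2 \<union> X3)"
      by (intro measure_pmf.finite_measure_mono) auto
    also have "\<dots> \<le> ?P X0 + ?P X1 + ?P X2 + ?P X3"
      by (intro measure_Un_le[THEN order.trans] add_mono order.refl) auto
    also have "\<dots> \<le> ?P X0 + 4 / real N + 2 / real N + 1 / real N"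
    proof (intro add_mono order.refl)
      show "?P X1 \<le> 4 / real N" unfolding X1_def by (rule prob_medium_primes_le[OF I N])
      have "?P X2 \<le> 1 / real q + 1 / real (2 * k + 1)"
        unfolding X2_def by (rule prob_dependent_column_le[OF I(1) I' q(1)])
      also have "\<dots> \<le> 1 / real N + 1 / real N" using q k N by (intro add_mono frac_le) auto
      finally show "?P X2 \<le> 2 / real N" by simp
      have "?P X3 \<le> real (r + 2) * (2 / real k)"
        unfolding X3_def using k by (intro prob_large_primes_le I) auto
      also have "\<dots> \<le> 1 / real N"
      proof -
        have "real (2 * N * (r + 2)) \<le> real k" using k by (simp only: of_nat_le_iff)
        then show ?thesis using k N by (simp add: field_simps)
      qed
      finally show "?P X3 \<le> 1 / real N" .
    qed
    finally show "?P {f. degenerate (Suc r) N f} \<le> ?P {f. degenerate r N f} + 7 / real N"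
      by (simp add: X0_def)
  qed
qed

lemma prob_degenerate_le:
  assumes "finite I" "{..<Suc r} \<times> {..<r} \<subseteq> I" and N: "1 \<le> N"
  shows "\<forall>\<^sub>F k in sequentially.
    measure_pmf.prob (uniform_box k I) {f. degenerate r N f} \<le> 7 * real r / real N"
  using assms(2)
proof (induction r)
  case 0
  then show ?case by (simp add: degenerate_def cols_dependent_mod_def)
next
  case (Suc r)
  have "{..<Suc r} \<times> {..<r} \<subseteq> I" using Suc.prems by auto
  from eventually_conj[OF Suc.IH[OF this] prob_degenerate_step[OF assms(1) Suc.prems N]]
  show ?case by (rule eventually_mono) (auto simp: add_divide_distrib distrib_left)
qed

section \<open>Densities of periodic sets\<close>

text \<open>
  Only the coordinates in \<open>I\<close> are compared, as the other ones are constant under the product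
  distributions.
\<close>
definition periodic_on :: "'a set \<Rightarrow> nat \<Rightarrow> (('a \<Rightarrow> int) \<Rightarrow> bool) \<Rightarrow> bool" where
  "periodic_on I q A \<longleftrightarrow> (\<forall>f g. (\<forall>x\<in>I. [f x = g x] (mod int q)) \<longrightarrow> A f = A g)"

abbreviation uniform_residues :: "nat \<Rightarrow> 'a set \<Rightarrow> ('a \<Rightarrow> int) pmf" where
  "uniform_residues q I \<equiv> Pi_pmf I 0 (\<lambda>_. pmf_of_set {0..<int q})"

lemma periodic_onD: "periodic_on I q A \<Longrightarrow> (\<And>x. x \<in> I \<Longrightarrow> [f x = g x] (mod int q)) \<Longrightarrow> A f = A g"
  unfolding periodic_on_def by blast

lemma periodic_on_dvd: "periodic_on I q A \<Longrightarrow> q dvd q' \<Longrightarrow> periodic_on I q' A"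
  unfolding periodic_on_def by (meson cong_dvd_modulus of_nat_dvd_iff)

text \<open>
  The upper bound counts a residue class directly; the lower bound follows because the
  probabilities of all \<open>q\<close> classes add up to one.
\<close>
lemma residue_box_limit:
  assumes q: "0 < q" and a: "0 \<le> a" "a < int q"
  shows "(\<lambda>k. pmf (map_pmf (\<lambda>y. y mod int q) (pmf_of_set {- int k..int k})) a) \<longlonglongrightarrow> 1 / real q"
proof -
  let ?p = "\<lambda>k. pmf (map_pmf (\<lambda>y. y mod int q) (pmf_of_set {- int k..int k}))"
  let ?e = "\<lambda>k. 1 / real (2 * k + 1)"
  have up: "?p k b \<le> 1 / real q + ?e k" for k b
  proof -
    define T where "T = {y \<in> {- int k..int k}. y mod int q = b}"
    have "?p k b = measure_pmf.prob (pmf_of_set {- int k..int k}) {y. y mod int q = b}"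
      by (simp add: pmf_map vimage_def)
    also have "\<dots> = real (card T) / real (2 * k + 1)"
    proof -
      have "T = {- int k..int k} \<inter> {y. y mod int q = b}" by (auto simp: T_def)
      then show ?thesis by (simp add: measure_pmf_of_set)
    qed
    also have "real (card T) \<le> real (2 * k + 1) * (1 / real q + ?e k)"
      using q by (intro card_residue_class_box_le) (auto simp: T_def mod_eq_dvd_iff[symmetric])
    finally show ?thesis by (simp add: divide_right_mono)
  qed
  have low: "1 / real q - real q * ?e k \<le> ?p k a" for k
  proof -
    have "(\<Sum>b\<in>{0..<int q}. ?p k b) = 1"
      using q by (intro sum_pmf_eq_1) auto
    then have "1 = ?p k a + (\<Sum>b\<in>{0..<int q} - {a}. ?p k b)"
      using a by (subst (asm) sum.remove[of _ a]) auto
    also have "(\<Sum>b\<in>{0..<int q} - {a}. ?p k b) \<le> (\<Sum>b\<in>{0..<int q} - {a}. 1 / real q + ?e k)"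
      by (intro sum_mono up)
    also have "\<dots> = (real q - 1) * (1 / real q + ?e k)"
      using a q by (simp add: of_nat_diff)
    also have "\<dots> = 1 - 1 / real q + real q * ?e k - ?e k"
    proof -
      have "(real q - 1) * (1 / real q + e) = 1 - 1 / real q + real q * e - e" for e
        using q by (simp add: field_simps)
      then show ?thesis .
    qed
    also have "\<dots> \<le> 1 - 1 / real q + real q * ?e k" by simp
    finally show ?thesis by simp
  qed
  have e: "?e \<longlonglongrightarrow> 0"
    by (rule LIMSEQ_subseq_LIMSEQ[OF lim_1_over_n, of "\<lambda>k. 2 * k + 1", unfolded o_def])
      (simp add: strict_mono_def)
  have "(\<lambda>k. 1 / real q + ?e k) \<longlonglongrightarrow> 1 / real q + 0" by (intro tendsto_intros e)
  moreover have "(\<lambda>k. 1 / real q - real q * ?e k) \<longlonglongrightarrow> 1 / real q - real q * 0"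
    by (intro tendsto_intros e)
  ultimately show ?thesis
    by (intro tendsto_sandwich[OF always_eventually always_eventually, OF allI allI, OF low up]) simp_all
qed

lemma prob_uniform_residues:
  assumes I: "finite I" and q: "0 < q"
  shows "measure_pmf.prob (uniform_residues q I) {f. A f}
    = real (card {f \<in> PiE_dflt I 0 (\<lambda>_. {0..<int q}). A f}) / real q ^ card I"
proof -
  have "uniform_residues q I = pmf_of_set (PiE_dflt I 0 (\<lambda>_. {0..<int q}))"
    using q by (intro Pi_pmf_of_set I) auto
  moreover have "PiE_dflt I 0 (\<lambda>_. {0..<int q}) \<inter> {f. A f} = {f \<in> PiE_dflt I 0 (\<lambda>_. {0..<int q}). A f}"
    by auto
  ultimately show ?thesis
    using I q by (simp add: measure_pmf_of_set card_PiE_dflt finite_PiE_dflt)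
qed

lemma periodic_box_limit:
  assumes I: "finite I" and q: "0 < q" and A: "periodic_on I q A"
  shows "(\<lambda>k. measure_pmf.prob (uniform_box k I) {f. A f})
    \<longlonglongrightarrow> measure_pmf.prob (uniform_residues q I) {f. A f}"
proof -
  define F where "F = {f \<in> PiE_dflt I 0 (\<lambda>_. {0..<int q}). A f}"
  have F: "finite F" unfolding F_def using I by (intro finite_subset[OF _ finite_PiE_dflt[OF I]]) auto
  define R where "R k = map_pmf (\<lambda>y. y mod int q) (pmf_of_set {- int k..int k})" for k
  have R: "set_pmf (R k) \<subseteq> {0..<int q}" for k using q by (auto simp: R_def)
  have Pk: "measure_pmf.prob (uniform_box k I) {f. A f} = (\<Sum>f\<in>F. \<Prod>x\<in>I. pmf (R k) (f x))" for k
  proof -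
    have "A f \<longleftrightarrow> A ((\<lambda>y. y mod int q) \<circ> f)" for f
      by (intro periodic_onD[OF A]) (simp add: cong_def)
    then have "measure_pmf.prob (uniform_box k I) {f. A f}
        = measure_pmf.prob (Pi_pmf I 0 (\<lambda>_. R k)) {f. A f}"
      unfolding R_def by (subst Pi_pmf_map[OF I]) (auto simp: vimage_def)
    also have "\<dots> = measure_pmf.prob (Pi_pmf I 0 (\<lambda>_. R k)) F"
    proof -
      have "{f. A f} \<inter> set_pmf (Pi_pmf I 0 (\<lambda>_. R k)) = F \<inter> set_pmf (Pi_pmf I 0 (\<lambda>_. R k))"
        using set_Pi_pmf_subset'[OF I, of 0 "\<lambda>_. R k"] R[of k] unfolding F_def
        by (fastforce simp: PiE_dflt_def)
      then show ?thesis by (metis measure_Int_set_pmf)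
    qed
    also have "\<dots> = (\<Sum>f\<in>F. pmf (Pi_pmf I 0 (\<lambda>_. R k)) f)" by (rule measure_measure_pmf_finite[OF F])
    also have "\<dots> = (\<Sum>f\<in>F. \<Prod>x\<in>I. pmf (R k) (f x))"
      by (intro sum.cong refl pmf_Pi' I) (auto simp: F_def PiE_dflt_def)
    finally show ?thesis .
  qed
  have "(\<lambda>k. \<Sum>f\<in>F. \<Prod>x\<in>I. pmf (R k) (f x)) \<longlonglongrightarrow> (\<Sum>f\<in>F. \<Prod>x\<in>I. 1 / real q)"
    unfolding R_def
    by (intro tendsto_sum tendsto_prod residue_box_limit q) (auto simp: F_def PiE_dflt_def)
  also have "(\<Sum>f\<in>F. \<Prod>x\<in>I. 1 / real q) = measure_pmf.prob (uniform_residues q I) {f. A f}"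
    unfolding prob_uniform_residues[OF I q] F_def[symmetric] by (simp add: power_one_over)
  finally show ?thesis by (simp only: Pk)
qed

text \<open>
  By the Chinese remainder theorem, reduction modulo \<open>q\<close> and modulo \<open>q'\<close> are independent for a
  uniform residue modulo \<open>q * q'\<close>.
\<close>
lemma prob_coprime_moduli:
  assumes I: "finite I" and q: "0 < q" "0 < q'" "coprime q q'"
    and A: "periodic_on I q A" and B: "periodic_on I q' B"
  shows "measure_pmf.prob (uniform_residues (q * q') I) {f. A f \<and> B f}
    = measure_pmf.prob (uniform_residues q I) {f. A f} * measure_pmf.prob (uniform_residues q' I) {f. B f}"
proof -
  let ?F = "\<lambda>q. PiE_dflt I 0 (\<lambda>_. {0..<int q})"
  define red where "red f = ((\<lambda>x. f x mod int q), (\<lambda>x. f x mod int q'))" for f :: "'a \<Rightarrow> int"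
  have redA: "A (\<lambda>x. f x mod int q) \<longleftrightarrow> A f" for f by (intro periodic_onD[OF A]) (simp add: cong_def)
  have redB: "B (\<lambda>x. f x mod int q') \<longleftrightarrow> B f" for f by (intro periodic_onD[OF B]) (simp add: cong_def)
  have "bij_betw red {f \<in> ?F (q * q'). A f \<and> B f} ({f \<in> ?F q. A f} \<times> {f \<in> ?F q'. B f})"
  proof (rule bij_betw_imageI)
    show "inj_on red {f \<in> ?F (q * q'). A f \<and> B f}"
    proof (rule inj_onI)
      fix f g assume f: "f \<in> {f \<in> ?F (q * q'). A f \<and> B f}" and g: "g \<in> {f \<in> ?F (q * q'). A f \<and> B f}"
        and eq: "red f = red g"
      show "f = g"
      proof
        fix x
        have "[f x = g x] (mod int q)" "[f x = g x] (mod int q')"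
          using eq by (auto simp: red_def cong_def dest: fun_cong)
        then have "[f x = g x] (mod int q * int q')"
          using q(3) by (intro coprime_cong_mult) auto
        then show "f x = g x"
          using f g by (cases "x \<in> I") (auto simp: PiE_dflt_def cong_def)
      qed
    qed
    show "red ` {f \<in> ?F (q * q'). A f \<and> B f} = {f \<in> ?F q. A f} \<times> {f \<in> ?F q'. B f}"
    proof (intro equalityI subsetI)
      fix z assume "z \<in> red ` {f \<in> ?F (q * q'). A f \<and> B f}"
      then show "z \<in> {f \<in> ?F q. A f} \<times> {f \<in> ?F q'. B f}"
        using q redA redB by (auto simp: red_def PiE_dflt_def)
    next
      fix z assume "z \<in> {f \<in> ?F q. A f} \<times> {f \<in> ?F q'. B f}"
      then obtain g h where z: "z = (g,h)" "g \<in> ?F q" "A g" "h \<in> ?F q'" "B h" by auto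
      have "\<exists>y. [y = g x] (mod int q) \<and> [y = h x] (mod int q')" for x
        using q(3) by (intro binary_chinese_remainder_int) auto
      then obtain y where y: "\<And>x. [y x = g x] (mod int q)" "\<And>x. [y x = h x] (mod int q')" by metis
      define f where "f x = (if x \<in> I then y x mod (int q * int q') else 0)" for x
      have "(\<lambda>x. f x mod int q) = g"
      proof
        fix x show "f x mod int q = g x"
          using z(2) y(1)[of x] by (auto simp: f_def PiE_dflt_def cong_def mod_mod_cancel)
      qed
      moreover have "(\<lambda>x. f x mod int q') = h"
      proof
        fix x show "f x mod int q' = h x"
          using z(4) y(2)[of x] by (auto simp: f_def PiE_dflt_def cong_def mod_mod_cancel)
      qed
      moreover have "f \<in> ?F (q * q')" using q by (auto simp: f_def PiE_dflt_def)
      ultimately show "z \<in> red ` {f \<in> ?F (q * q'). A f \<and> B f}"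
        using z redA[of f] redB[of f] by (intro image_eqI[of _ _ f]) (auto simp: red_def)
    qed
  qed
  then have "card {f \<in> ?F (q * q'). A f \<and> B f} = card {f \<in> ?F q. A f} * card {f \<in> ?F q'. B f}"
    by (simp add: bij_betw_same_card card_cartesian_product)
  moreover have "0 < q * q'" using q by simp
  ultimately show ?thesis
    using q(1,2) by (simp only: prob_uniform_residues[OF I]) (simp add: power_mult_distrib)
qed

lemma periodic_on_Ball_lessThan:
  fixes q :: "nat \<Rightarrow> nat"
  assumes "\<And>j. periodic_on I (q j) (A j)"
  shows "periodic_on I (\<Prod>j<N. q j) (\<lambda>f. \<forall>j<N. A j f)"
proof -
  have "periodic_on I (\<Prod>j<N. q j) (A j)" if "j < N" for j
    using that by (intro periodic_on_dvd[OF assms] dvd_prodI) auto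
  then show ?thesis unfolding periodic_on_def by blast
qed

lemma prob_pairwise_coprime_moduli:
  fixes q :: "nat \<Rightarrow> nat"
  assumes I: "finite I" and q: "\<And>j. 0 < q j" "\<And>i j. i \<noteq> j \<Longrightarrow> coprime (q i) (q j)"
    and A: "\<And>j. periodic_on I (q j) (A j)"
  shows "measure_pmf.prob (uniform_residues (\<Prod>j<N. q j) I) {f. \<forall>j<N. A j f}
    = (\<Prod>j<N. measure_pmf.prob (uniform_residues (q j) I) {f. A j f})"
proof (induction N)
  case (Suc N)
  have "measure_pmf.prob (uniform_residues ((\<Prod>j<N. q j) * q N) I) {f. (\<forall>j<N. A j f) \<and> A N f}
      = measure_pmf.prob (uniform_residues (\<Prod>j<N. q j) I) {f. \<forall>j<N. A j f}
        * measure_pmf.prob (uniform_residues (q N) I) {f. A N f}"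
    using q by (intro prob_coprime_moduli I periodic_on_Ball_lessThan A prod_coprime_left) auto
  moreover have "(\<forall>j<Suc N. A j f) \<longleftrightarrow> (\<forall>j<N. A j f) \<and> A N f" for f
    by (auto simp: less_Suc_eq)
  ultimately show ?case by (simp only: Suc prod.lessThan_Suc)
qed simp

section \<open>The density as an Euler product\<close>

lemma prime_nth_prime: "prime (nth_prime j)"
  using enumerate_in_set[OF primes_infinite, of j] by (simp add: nth_prime_def)

lemma nth_prime_eq_iff: "nth_prime i = nth_prime j \<longleftrightarrow> i = j"
  using inj_enumerate[OF primes_infinite] by (auto simp: nth_prime_def inj_def)

lemma prime_iff_nth_prime: "prime p \<longleftrightarrow> (\<exists>j. p = nth_prime j)"
  using enumerate_Ex[OF primes_infinite, of p] prime_nth_prime unfolding nth_prime_def by auto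

lemma le_nth_prime: "j \<le> nth_prime j"
  unfolding nth_prime_def by (rule le_enumerate[OF primes_infinite])

lemma multiplicity_prod_nth_prime:
  assumes "finite {j. s j \<noteq> 0}"
  shows "multiplicity (nth_prime i) (\<Prod>j | s j \<noteq> 0. nth_prime j ^ s j) = s i"
proof -
  let ?A = "{j. s j \<noteq> 0}"
  have inj: "inj_on nth_prime ?A" by (auto simp: inj_on_def nth_prime_eq_iff)
  have "(\<Prod>j | s j \<noteq> 0. nth_prime j ^ s j)
      = (\<Prod>p\<in>nth_prime ` ?A. p ^ s (inv_into UNIV nth_prime p))"
    using inj by (subst prod.reindex) (auto simp: inv_f_f inj_def nth_prime_eq_iff)
  moreover have "multiplicity (nth_prime i) (\<Prod>p\<in>nth_prime ` ?A. p ^ s (inv_into UNIV nth_prime p))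
      = (if nth_prime i \<in> nth_prime ` ?A then s (inv_into UNIV nth_prime (nth_prime i)) else 0)"
    using assms prime_nth_prime by (intro multiplicity_prod_prime_powers) auto
  ultimately show ?thesis by (auto simp: inv_f_f inj_def nth_prime_eq_iff)
qed

theorem theorem3p8:
  fixes n m r z :: nat and d s :: "nat \<Rightarrow> nat" and S :: "int mat set"
  assumes "1 \<le> m" and "m \<le> n"
    and "1 \<le> r" and "r \<le> min m (n - 1)"
    and "\<And>i. i < r \<Longrightarrow> 0 < d i"
    and "\<And>i. Suc i < r \<Longrightarrow> d i dvd d (Suc i)"
    and "finite {j. s j \<noteq> 0}"
    and "z = (\<Prod>j | s j \<noteq> 0. nth_prime j ^ s j)"
    and "d (r - 1) dvd z"
    and "S = {D \<in> smith_matrices n m. \<forall>i<r. D $$ (i,i) = int (d i)}"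
  shows "convergent (\<lambda>k. mu_box n m k S) \<and>
    (\<lambda>N. \<Prod>j<N. mu_mod n m (nth_prime j ^ (s j + 1)) S) \<longlonglongrightarrow> mu n m S"
proof -
  define I where "I = {..<n} \<times> {..<m}"
  define q where "q j = nth_prime j ^ Suc (s j)" for j
  define E where "E f \<longleftrightarrow> (\<exists>D\<in>S. is_snf (mat n m f) D)" for f
  define L where "L j f \<longleftrightarrow> snf_in_mod (q j) S (mat n m f)" for j f
  let ?P = "\<lambda>k A. measure_pmf.prob (uniform_box k I) {f. A f}"
  have I: "finite I" by (simp add: I_def)
  have S: "S = smith_with n m r d" using assms(10) by (simp add: smith_with_def)
  have r: "1 \<le> r" "r \<le> m" "Suc r \<le> n" using assms(1-4) by auto
  have z: "z \<noteq> 0" unfolding assms(8) using assms(7) prime_gt_0_nat[OF prime_nth_prime] by simp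
  have mult_z: "multiplicity (nth_prime j) z = s j" for j
    unfolding assms(8) by (rule multiplicity_prod_nth_prime[OF assms(7)])
  have d_z: "d i dvd z" if "i < r" for i
  proof -
    have "d i dvd d (r - 1)"
    proof (rule inc_induct[of i "r - 1" "\<lambda>i. d i dvd d (r - 1)"])
      show "d j dvd d (r - 1)" if "j < r - 1" "d (Suc j) dvd d (r - 1)" for j
        using assms(6)[of j] that by (auto intro: dvd_trans)
    qed (use that in auto)
    then show ?thesis using assms(9) dvd_trans by blast
  qed
  have d_pow: "\<not> p ^ Suc (multiplicity p z) dvd d i" if "i < r" "prime p" for i p
  proof
    assume "p ^ Suc (multiplicity p z) dvd d i"
    then have "p ^ Suc (multiplicity p z) dvd z" using d_z[OF that(1)] dvd_trans by blast
    then show False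
      using z that(2) by (metis not_less_eq_eq not_prime_unit order.refl power_dvd_iff_le_multiplicity)
  qed
  have E_iff: "E f \<longleftrightarrow> (\<forall>j. L j f)" for f
  proof -
    have "E f \<longleftrightarrow> (\<forall>p. prime p \<longrightarrow> snf_in_mod (p ^ Suc (multiplicity p z)) S (mat n m f))"
      unfolding E_def S using assms(2,5) r d_pow
      by (intro exists_snf_in_smith_with_iff) auto
    also have "\<dots> \<longleftrightarrow> (\<forall>j. L j f)"
      using mult_z by (auto simp: prime_iff_nth_prime L_def q_def)
    finally show ?thesis .
  qed
  have q_pos: "0 < q j" for j using prime_gt_0_nat[OF prime_nth_prime] by (simp add: q_def)
  have q_coprime: "coprime (q i) (q j)" if "i \<noteq> j" for i j
    using that prime_nth_prime by (simp add: q_def primes_coprime nth_prime_eq_iff del: power_Suc)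
  have L_periodic: "periodic_on I (q j) (L j)" for j
    unfolding periodic_on_def L_def
  proof (intro allI impI snf_in_mod_cong)
    fix f g :: "nat \<times> nat \<Rightarrow> int" assume "\<forall>x\<in>I. [f x = g x] (mod int (q j))"
    then show "cong_mat (q j) (mat n m f) (mat n m g)" by (auto simp: cong_mat_def I_def)
  qed
  have mu_box: "mu_box n m k S = ?P k E" for k
    by (simp add: mu_box_def random_mat_def E_def I_def vimage_def)
  have mu_mod: "mu_mod n m (nth_prime j ^ (s j + 1)) S
      = measure_pmf.prob (uniform_residues (q j) I) {f. L j f}" for j
    by (simp add: mu_mod_def random_mat_def L_def I_def q_def vimage_def)
  define w where "w N = (\<Prod>j<N. mu_mod n m (nth_prime j ^ (s j + 1)) S)" for N
  have w_limit: "(\<lambda>k. ?P k (\<lambda>f. \<forall>j<N. L j f)) \<longlonglongrightarrow> w N" for N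
  proof -
    have "w N = measure_pmf.prob (uniform_residues (\<Prod>j<N. q j) I) {f. \<forall>j<N. L j f}"
      unfolding w_def mu_mod
      by (rule prob_pairwise_coprime_moduli[OF I q_pos q_coprime L_periodic, symmetric])
    moreover have "0 < (\<Prod>j<N. q j)" using q_pos by (intro prod_pos) auto
    ultimately show ?thesis
      by (simp only:) (intro periodic_box_limit I periodic_on_Ball_lessThan L_periodic)
  qed
  have mu_mod_01: "0 \<le> mu_mod n m Q S" "mu_mod n m Q S \<le> 1" for Q by (simp_all add: mu_mod_def)
  have "decseq w"
    by (rule decseq_SucI) (auto simp: w_def mu_mod_01 simp del: power_Suc intro!: mult_right_le_one_le prod_nonneg)
  then obtain l where l: "w \<longlonglongrightarrow> l" "\<And>N. l \<le> w N"
    using decseq_convergent[of w 0] by (auto simp: w_def mu_mod_01 prod_nonneg)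
  obtain N0 where N0: "\<And>j. N0 \<le> j \<Longrightarrow> s j = 0"
  proof -
    obtain N0 where "\<forall>j\<in>{j. s j \<noteq> 0}. j < N0"
      using assms(7) by (auto simp: finite_nat_set_iff_bounded)
    then show ?thesis by (intro that[of N0]) (auto simp: not_less[symmetric])
  qed
  \<comment> \<open>Past \<open>N0\<close> every exponent vanishes, and \<open>nth_prime j \<ge> j > N\<close>.\<close>
  have tail: "E f \<or> degenerate r N f" if "\<forall>j<max N0 (Suc N). L j f" for f N
  proof (rule ccontr)
    assume neg: "\<not> (E f \<or> degenerate r N f)"
    then obtain j where j: "\<not> L j f" by (auto simp: E_iff)
    then have j': "N0 \<le> j" "N < j" using that by (meson Suc_le_eq leI max.strict_coboundedI1 max.strict_coboundedI2)+
    have "cols_dependent_mod (nth_prime j) (Suc r) r (\<lambda>(i,j). mat n m f $$ (i,j))"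
    proof (rule cols_dependent_if_not_snf_in_mod)
      show "\<not> nth_prime j dvd d i" if "i < r" for i
        using d_pow[OF that prime_nth_prime, of j] mult_z[of j] N0[OF j'(1)] by simp
      show "\<not> snf_in_mod (nth_prime j) (smith_with n m r d) (mat n m f)"
        using j N0[OF j'(1)] by (simp add: L_def q_def S)
    qed (use assms(2,6) r prime_nth_prime in auto)
    then have "cols_dependent_mod (nth_prime j) (Suc r) r f"
      using r by (subst (asm) cols_dependent_mod_cong[of _ _ _ f]) auto
    then have "degenerate r N f"
      unfolding degenerate_def using prime_nth_prime le_nth_prime[of j] j'(2) by (meson less_le_trans)
    then show False using neg by blast
  qed
  have "(\<lambda>k. ?P k E) \<longlonglongrightarrow> l"
  proof (rule LIMSEQ_I)
    fix e :: real assume e: "0 < e"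
    obtain N where N: "1 \<le> N" "7 * real r / real N < e / 2"
    proof -
      obtain N where N: "14 * real r / e < real N" using reals_Archimedean2 by blast
      moreover have "0 < 14 * real r / e" using e r by simp
      ultimately have "0 < real N" by linarith
      then show ?thesis using N e by (intro that[of N]) (auto simp: field_simps)
    qed
    define N1 where "N1 = max N0 (Suc N)"
    have "\<forall>\<^sub>F M in sequentially. \<bar>w M - l\<bar> < e / 2"
      using tendstoD[OF l(1), of "e / 2"] e by (simp add: dist_real_def)
    then obtain N2 where N2: "\<And>M. N2 \<le> M \<Longrightarrow> \<bar>w M - l\<bar> < e / 2"
      by (auto simp: eventually_sequentially)
    have "\<forall>\<^sub>F k in sequentially. \<bar>?P k (\<lambda>f. \<forall>j<N2. L j f) - w N2\<bar> < e / 2"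
      using tendstoD[OF w_limit[of N2], of "e / 2"] e by (simp add: dist_real_def)
    moreover have "\<forall>\<^sub>F k in sequentially. \<bar>?P k (\<lambda>f. \<forall>j<N1. L j f) - w N1\<bar> < e / 2"
      using tendstoD[OF w_limit[of N1], of "e / 2"] e by (simp add: dist_real_def)
    moreover have "\<forall>\<^sub>F k in sequentially. ?P k (degenerate r N) \<le> 7 * real r / real N"
      using r by (intro prob_degenerate_le I N(1)) (auto simp: I_def)
    ultimately have "\<forall>\<^sub>F k in sequentially. norm (?P k E - l) < e"
    proof eventually_elim
      case (elim k)
      have "?P k E \<le> ?P k (\<lambda>f. \<forall>j<N2. L j f)"
        by (intro measure_pmf.finite_measure_mono) (auto simp: E_iff)
      then have upper: "?P k E < l + e" using elim(1) N2[of N2] by linarith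
      have "?P k (\<lambda>f. \<forall>j<N1. L j f) \<le> measure_pmf.prob (uniform_box k I) ({f. E f} \<union> {f. degenerate r N f})"
        using tail[of N] by (intro measure_pmf.finite_measure_mono) (auto simp: N1_def)
      also have "\<dots> \<le> ?P k E + ?P k (degenerate r N)" by (intro measure_Un_le) auto
      finally have "l - e < ?P k E" using elim(2,3) N(2) l(2)[of N1] by linarith
      then show ?case using upper by (simp add: abs_less_iff)
    qed
    then show "\<exists>k0. \<forall>k\<ge>k0. norm (?P k E - l) < e" by (simp add: eventually_sequentially)
  qed
  then have lim: "(\<lambda>k. mu_box n m k S) \<longlonglongrightarrow> l" by (simp add: mu_box)
  then have "mu n m S = l" unfolding mu_def by (rule limI)
  then show ?thesis using lim l(1) unfolding w_def convergent_def by auto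
qed

end
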